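(* Let $1<b<c$ be integers and $A=\{1,b,c\}$. Write $c=q(b+1)+r$ with $q=\lfloor c/(b+1)\rfloor$ and $0\le r\le b$; when $b$ is even put $k=b/2$, and when $b-r$ is even put $\gamma=(b-r-2)/2$. Then: (i) if $b,c$ are odd: $\operatorname{per}(A)=2$, $\operatorname{preper}(A)=0$, $w^A=(01)^\infty$; (ii) if $b$ is odd and $c$ even: $\operatorname{per}(A)=b+c$, $\operatorname{preper}(A)=0$, $w^A=((01)^{c/2}1^b)^\infty$; (iii) if $b$ is even and $c=b+1$: $\operatorname{per}(A)=2b$, $\operatorname{preper}(A)=0$, $w^A=((01)^k1^b)^\infty$; (iv) if $b$ is even and $r\in\{1,b\}$: $\operatorname{per}(A)=b+1$, $\operatorname{preper}(A)=0$, $w^A=((01)^k1)^\infty$; (v) if $b$ is even and $r>1$ is odd: $\operatorname{per}(A)=b+c$, $\operatorname{preper}(A)=0$, $w^A=\big(((01)^k1)^{q+1}1^{r-1}\big)^\infty$; (vi) if $b$ is even and $r=b-2$: $\operatorname{per}(A)=c+1$, $\operatorname{preper}(A)=0$, $w^A=\big(((01)^k1)^q(01)^{k-1}1\big)^\infty$; (vii) if $b$ is even, $c>b+1$, $r<b-2$ is even and $q>\gamma$: $\operatorname{per}(A)=c+1$ and $\operatorname{preper}(A)=\gamma(b+c+2)-b-1$; (viii) if $b$ is even, $c>b+1$, $r<b-2$ is even and $q<\gamma$: $\operatorname{per}(A)=b+c$ and $\operatorname{preper}(A)=q(b+c+2)-b-1$; (ix) if $b$ is even, $c>b+1$, $r<b-2$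 is even and $q=\gamma$: $\operatorname{per}(A)=b-1$ and $\operatorname{preper}(A)=q(b+c+2)-b-1$. Moreover in cases (vii)–(ix), $w^A=T_0T_1\cdots T_{\mu-1}P^\infty$, where $\mu=\min(q,\gamma)$, $$T_i=((01)^k1)^{q-i}\,((01)^{k-1}1)^i\,(01)^{r/2+i}\,1^{2(\gamma-i)+1}\,(01)^{k-(\gamma-i)}\,1,$$ and $P=((01)^k1)^{q-\gamma}((01)^{k-1}1)^{\gamma+1}$ if $\gamma\le q$, while $P=((01)^{k-1}1)^q(01)^{r/2+q}1^{2(\gamma-q)+1}(01)^{r/2+q}1$ if $\gamma\ge q$.
   Context: For a finite nonempty set $A$ of positive integers, $w^A:\mathbb{Z}\to\{0,1\}$ is defined by $w^A(n)=1$ for $n<0$ and $w^A(n)=1-\min\{w^A(n-x):x\in A\}$ for $n\ge0$. $\operatorname{per}(A)$ is the least $p\ge1$ such that $w^A(n)=w^A(n+p)$ for all sufficiently large $n$, and $\operatorname{preper}(A)$ is the least $N\ge0$ with $w^A(n)=w^A(n+\operatorname{per}(A))$ for all $n\ge N$. "$w^A=Y$" for a string/infinite word $Y$ means the sequence $w^A(0),w^A(1),\ldots$ equals $Y$. Notation: juxtaposition is concatenation, $0^m,1^m$ strings of $m$ zeros/ones, $X^m$ $m$-fold repetition, $X^\infty$ infinite repetition. *)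

theory Defs
  imports Complex_Main "HOL-Library.Omega_Words_Fun"
begin

text \<open>The filter on positive elements only serves to make the recursion terminate for every
  argument; for sets of positive integers it does nothing, see \<open>wseq_unfold\<close> below.\<close>

function wseq :: "nat set \<Rightarrow> int \<Rightarrow> int" where
  "wseq A n =
     (if n < 0 then 1 else 1 - Min ((\<lambda>x. wseq A (n - int x)) ` {x \<in> A. 0 < x}))"
  by pat_completeness auto
termination
  by (relation "measure (\<lambda>(A, n). nat (n + 1))") auto

declare wseq.simps [simp del]

lemma wseq_unfold:
  assumes "\<And>x. x \<in> A \<Longrightarrow> 0 < x"
  shows "wseq A n = (if n < 0 then 1 else 1 - Min {wseq A (n - int x) | x. x \<in> A})"
proof -
  have "{x \<in> A. 0 < x} = A"
    using assms by blast
  then show ?thesis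
    by (subst wseq.simps) (simp add: Setcompr_eq_image)
qed

text \<open>For finite nonempty sets of positive integers the sequence is ultimately periodic, so that
  both \<open>LEAST\<close> are over nonempty sets; for other arguments \<open>per\<close> and \<open>preper\<close> carry no meaning.\<close>

definition per :: "nat set \<Rightarrow> nat" where
  "per A = (LEAST p. 1 \<le> p \<and>
     (\<forall>\<^sub>F n in sequentially. wseq A (int n) = wseq A (int n + int p)))"

definition preper :: "nat set \<Rightarrow> nat" where
  "preper A = (LEAST N. \<forall>n\<ge>N. wseq A (int n) = wseq A (int n + int (per A)))"

definition wword :: "nat set \<Rightarrow> int word" where
  "wword A = (\<lambda>n. wseq A (int n))"

definition word_pow :: "'a list \<Rightarrow> nat \<Rightarrow> 'a list"  (infixr "\<up>" 80) where
  "X \<up> m = concat (replicate m X)"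

end

theory Submission
  imports Defs
begin

text \<open>
  A position $n \ge 0$ carries a zero iff none of $n-1$, $n-b$, $n-c$ does. Zeros determine ones at
  the positions shifted by $1$, $b$ and $c$, so a period $b+c$ (resp. $c+1$) propagates from a
  window: $n+(b+c)$ looks back at $n+c$ and $n+b$ (resp. $n+(c+1)$ looks back at $n+1$), which are
  ones whenever $n$ is a zero.

  In cases (vi)--(ix) the word $T_{i+1}$, placed $b+c+2$ positions after $T_i$, is forced by $T_i$
  as long as $i < q$ and $i < \gamma$: a shift by $c$ moves every alternating block onto
  the ones of its predecessor. When $i$ reaches $q$ or $\gamma$, one of the two periods sets in.
  Minimality follows since $P$ contains a factor that occurs once per period.
\<close>


section \<open>The zeros of the sequence\<close>

text \<open>Call (01)^k 1 a long and (01)^{k-1} 1 a short block. The shift b+c+2 is c, plus the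
  length of a long block, plus one: looking back by c from a long block of T_{i+1} leads to the next
  long block of T_i, displaced by one place, so that zeros face ones. This costs one long block per
  step. In exchange a new short block appears, because the zero after the run of 2(\<gamma>-i)+1
  ones lies c places before the spot where a long block would have its last zero. Long blocks are
  used up at i = q, and at i = \<gamma> the run has shrunk to a single one, which closes the
  alternating part before it to a further short block. When both happen together, only \<gamma>+1
  short blocks remain and c+1 = (\<gamma>+1)(b-1); this is the source of the third period b-1. The
  preperiod ends inside the last T_i, just after the first letter of its run of ones: from there on
  the word already agrees with its translate by the period. Positions are integers, so that a
  look-back beyond the start meets a position that is not a zero and needs no separate
  treatment.\<close>

locale subtraction_game =
  fixes z :: "int \<Rightarrow> bool" and b c :: int
  assumes b_gt_1: "1 < b" and b_less_c: "b < c"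
    and z_iff: "z n \<longleftrightarrow> 0 \<le> n \<and> \<not> z (n - 1) \<and> \<not> z (n - b) \<and> \<not> z (n - c)"
begin

lemma zI: "0 \<le> n \<Longrightarrow> \<not> z (n - 1) \<Longrightarrow> \<not> z (n - b) \<Longrightarrow> \<not> z (n - c) \<Longrightarrow> z n"
  using z_iff[of n] by blast

lemma not_z_neg: "n < 0 \<Longrightarrow> \<not> z n"
  using z_iff[of n] by auto

lemma not_z_add_1: "z m \<Longrightarrow> n = m + 1 \<Longrightarrow> \<not> z n"
  using z_iff[of n] by auto

lemma not_z_add_b: "z m \<Longrightarrow> n = m + b \<Longrightarrow> \<not> z n"
  using z_iff[of n] by auto

lemma not_z_add_c: "z m \<Longrightarrow> n = m + c \<Longrightarrow> \<not> z n"
  using z_iff[of n] by auto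

lemma not_zE [consumes 2]:
  assumes "\<not> z n" "0 \<le> n"
  obtains "z (n - 1)" | "z (n - b)" | "z (n - c)"
  using z_iff[of n] assms by blast

text \<open>Only even offsets need a check of the look-backs by \<open>b\<close> and
  \<open>c\<close>: a position at an odd offset directly follows a zero.\<close>

lemma alternating:
  assumes "0 \<le> n" "\<not> z (n - 1)"
    and "\<And>s. even s \<Longrightarrow> 0 \<le> s \<Longrightarrow> s < m \<Longrightarrow> \<not> z (n + s - b) \<and> \<not> z (n + s - c)"
    and "0 \<le> s" "s < m"
  shows "z (n + s) \<longleftrightarrow> even s"
proof -
  have "s < m \<longrightarrow> (z (n + s) \<longleftrightarrow> even s)" if "0 \<le> s" for s
    using that
  proof (induction s rule: int_ge_induct)
    case base
    show ?case using zI[of n] assms(1,2) assms(3)[of 0] by auto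
  next
    case (step s)
    show ?case
    proof
      assume less: "s + 1 < m"
      show "z (n + (s + 1)) \<longleftrightarrow> even (s + 1)"
      proof (cases "even s")
        case True
        then have "z (n + s)" using step less by auto
        then show ?thesis using not_z_add_1[of "n + s" "n + (s + 1)"] True by auto
      next
        case False
        then have "\<not> z (n + (s + 1) - 1)" using step less by (simp add: algebra_simps)
        then show ?thesis
          using zI[of "n + (s + 1)"] assms(1) assms(3)[of "s + 1"] less False step.hyps by auto
      qed
    qed
  qed
  then show ?thesis using assms(4,5) by auto
qed

lemma period_b_plus_c:
  assumes M: "0 \<le> M" and start: "\<not> z (M - 1)" "\<not> z (M + b + c - 1)"
    and one: "\<And>n. M \<le> n \<Longrightarrow> n < M + c \<Longrightarrow> \<not> z n \<Longrightarrow>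
      z (n - 1) \<or> z (n + b) \<or> z (n + c) \<or> M \<le> n - b \<and> z (n - b)"
    and "M \<le> n"
  shows "z (n + (b + c)) \<longleftrightarrow> z n"
  using \<open>M \<le> n\<close>
proof (induction "nat (n - M)" arbitrary: n rule: less_induct)
  case less
  have IH: "z (m + (b + c)) \<longleftrightarrow> z m" if "M \<le> m" "m < n" for m
    by (rule less.hyps) (use that in auto)
  have prev: "z (n + (b + c) - 1) \<longleftrightarrow> z (n - 1)"
  proof (cases "n = M")
    case False
    then show ?thesis using IH[of "n - 1"] less.prems by (simp add: algebra_simps)
  qed (use start in \<open>simp add: algebra_simps\<close>)
  show ?case
  proof (cases "z n")
    case True
    then have "\<not> z (n + b)" "\<not> z (n + c)" "\<not> z (n - 1)"
      using not_z_add_b[of n] not_z_add_c[of n] z_iff[of n] by blast+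
    moreover have "n + (b + c) - c = n + b" "n + (b + c) - b = n + c" by auto
    ultimately have "z (n + (b + c))"
      using zI[of "n + (b + c)"] prev b_gt_1 b_less_c less.prems M by simp
    then show ?thesis using True by simp
  next
    case False
    have "z (n - 1) \<or> z (n + b) \<or> z (n + c)"
    proof (cases "n < M + c")
      case True
      then consider "z (n - 1) \<or> z (n + b) \<or> z (n + c)" | "M \<le> n - b" "z (n - b)"
        using one[of n] less.prems \<open>\<not> z n\<close> by blast
      then show ?thesis
        using IH[of "n - b"] b_gt_1 by cases (auto simp: algebra_simps)
    next
      case ge: False
      have "0 \<le> n" using less.prems M by simp
      from \<open>\<not> z n\<close> this show ?thesis
        using IH[of "n - b"] IH[of "n - c"] ge b_gt_1 b_less_c
        by (cases rule: not_zE) (auto simp: algebra_simps)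
    qed
    then have "\<not> z (n + (b + c))"
      using prev z_iff[of "n + (b + c)"] by (auto simp: algebra_simps)
    then show ?thesis using False by simp
  qed
qed

text \<open>In contrast to \<open>b + c\<close>, a zero at \<open>n\<close> leaves one look-back of
  \<open>n + (c + 1)\<close> open, namely \<open>n + c + 1 - b\<close>. This is \<open>n - b\<close>
  moved by the period, hence a one, unless \<open>n - b\<close> lies before \<open>M\<close>; the
  hypothesis \<open>zero\<close> is the check for that initial stretch.\<close>

lemma period_c_plus_1:
  assumes M: "0 \<le> M" and start: "\<not> z (M - 1)" "\<not> z (M + c)"
    and zero: "\<And>n. M \<le> n \<Longrightarrow> n < M + b \<Longrightarrow> z n \<Longrightarrow> \<not> z (n + c + 1 - b)"
    and one: "\<And>n. M \<le> n \<Longrightarrow> n < M + c \<Longrightarrow> \<not> z n \<Longrightarrow>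
      z (n - 1) \<or> z (n + 1) \<or> M \<le> n - b \<and> z (n - b)"
    and "M \<le> n"
  shows "z (n + (c + 1)) \<longleftrightarrow> z n"
  using \<open>M \<le> n\<close>
proof (induction "nat (n - M)" arbitrary: n rule: less_induct)
  case less
  have IH: "z (m + (c + 1)) \<longleftrightarrow> z m" if "M \<le> m" "m < n" for m
    by (rule less.hyps) (use that in auto)
  have prev: "z (n + c) \<longleftrightarrow> z (n - 1)"
  proof (cases "n = M")
    case False
    then show ?thesis using IH[of "n - 1"] less.prems by (simp add: algebra_simps)
  qed (use start in \<open>simp add: algebra_simps\<close>)
  show ?case
  proof (cases "z n")
    case True
    then have "\<not> z (n + 1)" "\<not> z (n - 1)" "\<not> z (n - b)"
      using not_z_add_1[of n] z_iff[of n] by blast+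
    moreover have "\<not> z (n + (c + 1) - b)"
    proof (cases "M \<le> n - b")
      case True
      then show ?thesis
        using IH[of "n - b"] b_gt_1 \<open>\<not> z (n - b)\<close> by (simp add: algebra_simps)
    next
      case False
      then show ?thesis using zero[of n] less.prems \<open>z n\<close> by (simp add: algebra_simps)
    qed
    moreover have "n + (c + 1) - 1 = n + c" "n + (c + 1) - c = n + 1" by auto
    ultimately have "z (n + (c + 1))"
      using zI[of "n + (c + 1)"] prev b_gt_1 b_less_c less.prems M by simp
    then show ?thesis using True by simp
  next
    case False
    have "z (n - 1) \<or> z (n + 1) \<or> z (n + (c + 1) - b)"
    proof (cases "n < M + c")
      case True
      then consider "z (n - 1) \<or> z (n + 1)" | "M \<le> n - b" "z (n - b)"
        using one[of n] less.prems \<open>\<not> z n\<close> by blast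
      then show ?thesis
        using IH[of "n - b"] b_gt_1 by cases (auto simp: algebra_simps)
    next
      case ge: False
      have "0 \<le> n" using less.prems M by simp
      from \<open>\<not> z n\<close> this show ?thesis
        using IH[of "n - b"] IH[of "n - c"] ge b_gt_1 b_less_c
        by (cases rule: not_zE) (auto simp: algebra_simps)
    qed
    then have "\<not> z (n + (c + 1))"
      using prev z_iff[of "n + (c + 1)"] by (auto simp: algebra_simps)
    then show ?thesis using False by simp
  qed
qed

text \<open>With the window at 0 every cause of a one is a nonnegative position, and
  \<open>m - c\<close> is negative throughout the window. Thus only the letter before the second
  period has to be inspected.\<close>

lemma pure_period_b_plus_c:
  assumes "\<not> z (b + c - 1)" "0 \<le> n"
  shows "z (n + (b + c)) \<longleftrightarrow> z n"
proof (rule period_b_plus_c[of 0])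
  fix m assume "0 \<le> m" "m < 0 + c" "\<not> z m"
  from \<open>\<not> z m\<close> \<open>0 \<le> m\<close>
  show "z (m - 1) \<or> z (m + b) \<or> z (m + c) \<or> 0 \<le> m - b \<and> z (m - b)"
    using not_z_neg[of "m - b"] not_z_neg[of "m - c"] \<open>m < 0 + c\<close>
    by (cases rule: not_zE) force+
qed (use assms not_z_neg in auto)

end

section \<open>Zero sets with a closed form: odd \<open>b\<close>, \<open>c = b + 1\<close>, and
  words made of long blocks\<close>

context subtraction_game
begin

text \<open>The guards make the values of \<open>v\<close> at negative arguments irrelevant, so
  formulas defined on all integers, such as parity, can be used; the bound \<open>N\<close> admits
  formulas that describe an initial segment only.\<close>

lemma z_unique:
  assumes "\<And>n. 0 \<le> n \<Longrightarrow> n < N \<Longrightarrow> v n \<longleftrightarrow>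
      \<not> (1 \<le> n \<and> v (n - 1)) \<and> \<not> (b \<le> n \<and> v (n - b)) \<and> \<not> (c \<le> n \<and> v (n - c))"
    and "0 \<le> n" "n < N"
  shows "z n \<longleftrightarrow> v n"
  using assms(2,3)
proof (induction "nat n" arbitrary: n rule: less_induct)
  case less
  have IH: "z (n - t) \<longleftrightarrow> t \<le> n \<and> v (n - t)" if "0 < t" for t
  proof (cases "t \<le> n")
    case True
    then show ?thesis using less.hyps[of "n - t"] less.prems that by simp
  next
    case False
    then show ?thesis using not_z_neg[of "n - t"] by simp
  qed
  show ?case
    using z_iff[of n] assms(1)[of n] IH[of 1] IH[of b] IH[of c] less.prems b_gt_1 b_less_c by auto
qed

text \<open>For even \<open>b\<close>, the zeros of the endless repetition of the long block,
  continued periodically to all integers. On nonnegative positions this is the zero set for the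
  smaller set {1, b}.\<close>

definition X_zero :: "int \<Rightarrow> bool" where
  "X_zero n \<longleftrightarrow> even (n mod (b + 1)) \<and> n mod (b + 1) < b"

lemma X_zero_iff:
  assumes "n = j * (b + 1) + s" "0 \<le> s" "s \<le> b"
  shows "X_zero n \<longleftrightarrow> even s \<and> s < b"
proof -
  have "n mod (b + 1) = s" using assms by simp
  then show ?thesis by (simp add: X_zero_def)
qed

lemma X_repr:
  obtains j s where "n = j * (b + 1) + s" "0 \<le> s" "s \<le> b" "0 \<le> n \<longrightarrow> 0 \<le> j"
  using div_mult_mod_eq[of n "b + 1"] pos_mod_bound[of "b + 1" n] pos_mod_sign[of "b + 1" n] b_gt_1
  by (intro that[of "n div (b + 1)" "n mod (b + 1)"]) (auto simp: pos_imp_zdiv_nonneg_iff)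

text \<open>Modulo \<open>b + 1\<close>, subtracting \<open>b\<close> is adding 1.\<close>

lemma X_zero_sub:
  assumes "n = j * (b + 1) + s" "0 \<le> s" "s \<le> b"
  shows "X_zero (n - 1) \<longleftrightarrow> 0 < s \<and> odd s" "X_zero (n - b) \<longleftrightarrow> s = b \<or> odd s \<and> s < b - 1"
proof -
  show "X_zero (n - 1) \<longleftrightarrow> 0 < s \<and> odd s"
    using X_zero_iff[of "n - 1" "j - 1" b] X_zero_iff[of "n - 1" j "s - 1"] assms b_gt_1
    by (cases "s = 0") (auto simp: algebra_simps)
  show "X_zero (n - b) \<longleftrightarrow> s = b \<or> odd s \<and> s < b - 1"
    using X_zero_iff[of "n - b" "j - 1" "s + 1"] X_zero_iff[of "n - b" j 0] assms b_gt_1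
    by (cases "s = b") (auto simp: algebra_simps)
qed

text \<open>The look-backs by 1 and \<open>b\<close> alone already produce this word: odd residues
  follow a zero, and residue \<open>b\<close> lies \<open>b\<close> places after residue 0. So
  \<open>c\<close> could only spoil it by joining two zeros.\<close>

lemma z_eq_X_zero:
  assumes "even b" and c: "\<And>n. c \<le> n \<Longrightarrow> n < N \<Longrightarrow> X_zero n \<Longrightarrow> \<not> X_zero (n - c)"
    and "0 \<le> n" "n < N"
  shows "z n \<longleftrightarrow> X_zero n"
proof (rule z_unique[OF _ assms(3,4)])
  fix n assume n: "0 \<le> n" "n < N"
  obtain j s where s: "n = j * (b + 1) + s" "0 \<le> s" "s \<le> b" and j: "0 \<le> n \<longrightarrow> 0 \<le> j"
    by (rule X_repr)
  have "0 \<le> j" using j n by simp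
  then have sn: "s \<le> n" using s b_gt_1 by simp
  note sub = X_zero_sub[OF s] and iff = X_zero_iff[OF s]
  show "X_zero n \<longleftrightarrow> \<not> (1 \<le> n \<and> X_zero (n - 1)) \<and> \<not> (b \<le> n \<and> X_zero (n - b)) \<and>
      \<not> (c \<le> n \<and> X_zero (n - c))"
  proof (cases "X_zero n")
    case True
    then show ?thesis using sub iff c[of n] n \<open>even b\<close> by auto
  next
    case False
    then have "odd s \<or> s = b" using iff s by auto
    then show ?thesis using False sub sn s by auto
  qed
qed

text \<open>All three steps change the parity.\<close>

lemma odd_odd:
  assumes "odd b" "odd c" "0 \<le> n"
  shows "z n \<longleftrightarrow> even n"
  by (rule z_unique[of "n + 1"]) (use assms b_gt_1 b_less_c in presburger)+

text \<open>From \<open>c\<close> on, even positions are covered by the zero \<open>c\<close> places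
  back and odd ones by the zero \<open>b\<close> places back; both look-backs still fall into the
  alternating stretch.\<close>

lemma odd_even_zeros:
  assumes "odd b" "even c"
  shows "0 \<le> n \<Longrightarrow> n < c \<Longrightarrow> z n \<longleftrightarrow> even n" "c \<le> n \<Longrightarrow> n < b + c \<Longrightarrow> \<not> z n"
proof -
  have 1: "z n \<longleftrightarrow> even n" if "0 \<le> n" "n < c" for n
    by (rule z_unique[of c]) (use assms that b_gt_1 b_less_c in presburger)+
  then show "0 \<le> n \<Longrightarrow> n < c \<Longrightarrow> z n \<longleftrightarrow> even n" .
  assume n: "c \<le> n" "n < b + c"
  show "\<not> z n"
  proof (cases "even n")
    case True
    then show ?thesis
      using 1[of "n - c"] not_z_add_c[of "n - c" n] n b_less_c assms by auto
  next
    case False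
    then show ?thesis
      using 1[of "n - b"] not_z_add_b[of "n - b" n] n b_less_c assms by auto
  qed
qed

lemma odd_even_period:
  assumes "odd b" "even c" "0 \<le> n"
  shows "z (n + (b + c)) \<longleftrightarrow> z n"
  by (rule pure_period_b_plus_c)
    (use odd_even_zeros(2)[OF assms(1,2), of "b + c - 1"] b_gt_1 assms in auto)

text \<open>Within a period every zero but the first has another zero two places before it, whereas
  the position two places before the next period is a one. A smaller period \<open>d\<close> would
  carry the first zero to one of the others. The same comparison at distance two settles
  \<open>consecutive_not_period\<close>, \<open>X_not_period\<close> and
  \<open>not_period_b_minus_1\<close>.\<close>

lemma odd_even_not_period:
  assumes "odd b" "even c" and d: "0 < d" "d < b + c"
  shows "\<exists>n\<ge>0. z (n + d) \<noteq> z n"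
proof (rule ccontr)
  assume "\<not> ?thesis"
  then have per_d: "z (n + d) \<longleftrightarrow> z n" if "0 \<le> n" for n using that by auto
  note zeros = odd_even_zeros[OF assms(1,2)]
  have "z d" using per_d[of 0] zeros(1)[of 0] b_gt_1 b_less_c by simp
  then have "d < c" "even d" using zeros[of d] d by force+
  then have "2 \<le> d" using d by presburger
  then have "z (d - 2)" using zeros(1)[of "d - 2"] \<open>d < c\<close> \<open>even d\<close> by simp
  then have "z (b + c - 2 + d)"
    using odd_even_period[OF assms(1,2), of "d - 2"] \<open>2 \<le> d\<close> by (simp add: algebra_simps)
  then show False
    using per_d[of "b + c - 2"] zeros(2)[of "b + c - 2"] b_gt_1 b_less_c by simp
qed

lemma consecutive_zeros:
  assumes "even b" "c = b + 1"
  shows "0 \<le> n \<Longrightarrow> n < b \<Longrightarrow> z n \<longleftrightarrow> even n" "b \<le> n \<Longrightarrow> n < 2 * b \<Longrightarrow> \<not> z n"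
proof -
  have 1: "z n \<longleftrightarrow> even n" if "0 \<le> n" "n < b" for n
    by (rule z_unique[of b]) (use assms that b_gt_1 b_less_c in presburger)+
  then show "0 \<le> n \<Longrightarrow> n < b \<Longrightarrow> z n \<longleftrightarrow> even n" .
  assume n: "b \<le> n" "n < 2 * b"
  show "\<not> z n"
  proof (cases "even n")
    case True
    then show ?thesis
      using 1[of "n - b"] not_z_add_b[of "n - b" n] n assms by auto
  next
    case False
    then have "b + 1 \<le> n" using n assms by presburger
    then show ?thesis
      using 1[of "n - c"] not_z_add_c[of "n - c" n] n False assms by auto
  qed
qed

text \<open>The period is \<open>b + c - 1\<close>, in general neither of the two that the window
  criteria treat. From \<open>2 * b\<close> on, the look-backs \<open>n + b\<close> and
  \<open>n + b - 1\<close> of \<open>n + 2 * b\<close> are \<open>n - b\<close> and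
  \<open>n - c\<close> moved by the period, so the recursion repeats itself; before that, the two
  explicit halves decide.\<close>

lemma consecutive_period:
  assumes "even b" "c = b + 1" "0 \<le> n"
  shows "z (n + 2 * b) \<longleftrightarrow> z n"
  using \<open>0 \<le> n\<close>
proof (induction "nat n" arbitrary: n rule: less_induct)
  case less
  note zeros = consecutive_zeros[OF assms(1,2)]
  have IH: "z (m + 2 * b) \<longleftrightarrow> z m" if "0 \<le> m" "m < n" for m
    by (rule less.hyps) (use that in auto)
  have iff: "z (n + 2 * b) \<longleftrightarrow> \<not> z (n + 2 * b - 1) \<and> \<not> z (n + b) \<and> \<not> z (n + b - 1)"
    using z_iff[of "n + 2 * b"] less.prems b_gt_1 assms(2) by (simp add: algebra_simps)
  have prev: "z (n + 2 * b - 1) \<longleftrightarrow> 1 \<le> n \<and> z (n - 1)"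
    using IH[of "n - 1"] zeros(2)[of "2 * b - 1"] less.prems b_gt_1
    by (cases "n = 0") (auto simp: algebra_simps)
  consider "n < b" | "b \<le> n" "n < 2 * b" "even n" | "b \<le> n" "n < 2 * b" "odd n" | "2 * b \<le> n"
    by linarith
  then show ?case
  proof cases
    case 1
    have "\<not> z (n + b)" using zeros(2)[of "n + b"] 1 less.prems by simp
    moreover have "\<not> z (n + b - 1)"
      using zeros(2)[of "n + b - 1"] zeros(1)[of "b - 1"] 1 less.prems b_gt_1 assms(1)
      by (cases "n = 0") auto
    moreover have "z n \<longleftrightarrow> \<not> (1 \<le> n \<and> z (n - 1))"
      using zeros(1)[of n] zeros(1)[of "n - 1"] 1 less.prems by (cases "n = 0") auto
    ultimately show ?thesis using iff prev by simp
  next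
    case 2
    then have "z (n + b)"
      using IH[of "n - b"] zeros(1)[of "n - b"] b_gt_1 assms(1) by (simp add: algebra_simps)
    then show ?thesis using iff zeros(2)[of n] 2 by simp
  next
    case 3
    then have "b + 1 \<le> n" using assms(1) by presburger
    then have "z (n + b - 1)"
      using IH[of "n - b - 1"] zeros(1)[of "n - b - 1"] 3 b_gt_1 assms(1)
      by (simp add: algebra_simps)
    then show ?thesis using iff zeros(2)[of n] 3 by simp
  next
    case 4
    have "z (n + b) \<longleftrightarrow> z (n - b)" "z (n + b - 1) \<longleftrightarrow> z (n - c)"
      using IH[of "n - b"] IH[of "n - c"] 4 b_gt_1 assms(2) by (auto simp: algebra_simps)
    then show ?thesis using iff prev z_iff[of n] 4 b_gt_1 by auto
  qed
qed

lemma consecutive_not_period: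
  assumes "even b" "c = b + 1" and d: "0 < d" "d < 2 * b"
  shows "\<exists>n\<ge>0. z (n + d) \<noteq> z n"
proof (rule ccontr)
  assume "\<not> ?thesis"
  then have per_d: "z (n + d) \<longleftrightarrow> z n" if "0 \<le> n" for n using that by auto
  note zeros = consecutive_zeros[OF assms(1,2)]
  have "z d" using per_d[of 0] zeros(1)[of 0] b_gt_1 by simp
  then have "d < b" "even d" using zeros[of d] d by force+
  then have "2 \<le> d" using d by presburger
  then have "z (d - 2)" using zeros(1)[of "d - 2"] \<open>d < b\<close> \<open>even d\<close> by simp
  then have "z (2 * b - 2 + d)"
    using consecutive_period[OF assms(1,2), of "d - 2"] \<open>2 \<le> d\<close> by (simp add: algebra_simps)
  then show False
    using per_d[of "2 * b - 2"] zeros(2)[of "2 * b - 2"] b_gt_1 by simp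
qed

lemma X_zero_period: "X_zero (n + (b + 1)) \<longleftrightarrow> X_zero n"
  by (simp add: X_zero_def)

text \<open>Here \<open>c\<close> is 1 or -1 modulo \<open>b + 1\<close>, and the cyclic neighbours
  of an even residue below \<open>b\<close> are odd or equal to \<open>b\<close>.\<close>

lemma X_zeros:
  assumes "even b" "c = q * (b + 1) + r" "r = 1 \<or> r = b" "0 \<le> n"
  shows "z n \<longleftrightarrow> X_zero n"
proof (rule z_eq_X_zero[of "n + 1"])
  fix n assume n: "X_zero n"
  obtain j s where s: "n = j * (b + 1) + s" "0 \<le> s" "s \<le> b" by (rule X_repr)
  have ev: "even s" "s < b" using n X_zero_iff[OF s] by auto
  show "\<not> X_zero (n - c)"
  proof (cases "r = 1")
    case True
    show ?thesis
      using X_zero_iff[of "n - c" "j - q" "s - 1"] X_zero_iff[of "n - c" "j - q - 1" b] True ev s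
        assms(2) b_gt_1
      by (cases "s = 0") (auto simp: algebra_simps)
  next
    case False
    then have "n - c = (j - q - 1) * (b + 1) + (s + 1)"
      using s assms(2,3) by (simp add: algebra_simps)
    then show ?thesis using X_zero_iff[of "n - c" "j - q - 1" "s + 1"] ev s by simp
  qed
qed (use assms in auto)

lemma X_zero_small: "0 \<le> n \<Longrightarrow> n \<le> b \<Longrightarrow> X_zero n \<longleftrightarrow> even n \<and> n < b"
  using X_zero_iff[of n 0 n] by simp

lemma X_not_period:
  assumes "even b" and zeros: "\<And>n. 0 \<le> n \<Longrightarrow> z n \<longleftrightarrow> X_zero n" and d: "0 < d" "d < b + 1"
  shows "\<exists>n\<ge>0. z (n + d) \<noteq> z n"
proof (rule ccontr)
  assume "\<not> ?thesis"
  then have per_d: "z (n + d) \<longleftrightarrow> z n" if "0 \<le> n" for n using that by auto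
  have "X_zero d" using per_d[of 0] zeros[of 0] zeros[of d] X_zero_small[of 0] b_gt_1 d by simp
  then have "even d" "d < b" using X_zero_small[of d] d by auto
  then have "2 \<le> d" using d by presburger
  then have "X_zero (d - 2)" using X_zero_small[of "d - 2"] \<open>d < b\<close> \<open>even d\<close> by simp
  then have "z (b - 1 + d)"
    using X_zero_period[of "d - 2"] zeros[of "b - 1 + d"] b_gt_1 \<open>2 \<le> d\<close>
    by (simp add: algebra_simps)
  then have "z (b - 1)" using per_d[of "b - 1"] b_gt_1 by simp
  then show False using zeros[of "b - 1"] X_zero_small[of "b - 1"] b_gt_1 \<open>even b\<close> by simp
qed

context
  fixes q r :: int
  assumes even_b: "even b" and c_eq: "c = q * (b + 1) + r" and r: "1 < r" "r \<le> b" "odd r"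
begin

lemma odd_r_less: "r < b"
  using r even_b by (cases "r = b") auto

text \<open>Between \<open>c\<close> and the end of the last long block, zeros have even residues
  while \<open>c\<close> has the odd residue \<open>r\<close>, so \<open>n - c\<close> is odd. After
  the \<open>q + 1\<close> long blocks, even offsets are covered by zeros of the first block
  (\<open>c\<close> places back) and odd offsets by zeros of the last block (\<open>b\<close> places
  back).\<close>

lemma odd_r_zeros:
  shows "0 \<le> n \<Longrightarrow> n < (q + 1) * (b + 1) \<Longrightarrow> z n \<longleftrightarrow> X_zero n"
    and "(q + 1) * (b + 1) \<le> n \<Longrightarrow> n < b + c \<Longrightarrow> \<not> z n"
proof -
  let ?N = "(q + 1) * (b + 1)"
  have N: "?N = c + (b + 1 - r)" using c_eq by (simp add: algebra_simps)
  have 1: "z n \<longleftrightarrow> X_zero n" if "0 \<le> n" "n < ?N" for n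
  proof (rule z_eq_X_zero[OF even_b])
    fix n assume n: "c \<le> n" "n < ?N" "X_zero n"
    have s: "n = q * (b + 1) + (n - c + r)" "0 \<le> n - c + r" "n - c + r \<le> b"
      using n N r by (auto simp: c_eq)
    have "odd (n - c)" using X_zero_iff[OF s] n(3) r by simp
    then show "\<not> X_zero (n - c)" using X_zero_small[of "n - c"] n N r by simp
  qed (use that in auto)
  then show "0 \<le> n \<Longrightarrow> n < ?N \<Longrightarrow> z n \<longleftrightarrow> X_zero n" .
  assume n: "?N \<le> n" "n < b + c"
  define u where "u = n - ?N"
  have u: "0 \<le> u" "u < r - 1" using n N by (auto simp: u_def)
  show "\<not> z n"
  proof (cases "even u")
    case True
    have "n - c = b + 1 - r + u" using N by (simp add: u_def)
    moreover have "even (b + 1 - r + u)" using True even_b r by simp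
    ultimately have "X_zero (n - c)"
      using X_zero_small[of "n - c"] u r by simp
    then have "z (n - c)"
      using 1[of "n - c"] n N r b_less_c b_gt_1 by simp
    then show ?thesis using not_z_add_c[of "n - c" n] by simp
  next
    case False
    have eq: "n - b = q * (b + 1) + (u + 1)" by (simp add: u_def algebra_simps)
    have "X_zero (n - b)" using X_zero_iff[OF eq] u r False by simp
    moreover have "n - b < ?N" "0 \<le> n - b" using n N r odd_r_less b_less_c by auto
    ultimately have "z (n - b)" using 1[of "n - b"] by simp
    then show ?thesis using not_z_add_b[of "n - b" n] by simp
  qed
qed

lemma odd_r_period: "0 \<le> n \<Longrightarrow> z (n + (b + c)) \<longleftrightarrow> z n"
  using odd_r_zeros(2)[of "b + c - 1"] c_eq r
  by (intro pure_period_b_plus_c) (auto simp: algebra_simps)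

text \<open>Read cyclically, the start of a period follows three ones, while inside the string of
  long blocks at most two ones precede a zero. Distance two rules out zeros inside a block, distance
  three those at the start of a later block.\<close>

lemma odd_r_not_period:
  assumes d: "0 < d" "d < b + c"
  shows "\<exists>n\<ge>0. z (n + d) \<noteq> z n"
proof (rule ccontr)
  assume "\<not> ?thesis"
  then have per_d: "z (n + d) \<longleftrightarrow> z n" if "0 \<le> n" for n using that by auto
  let ?N = "(q + 1) * (b + 1)"
  have N: "?N = b + c + 1 - r" using c_eq by (simp add: algebra_simps)
  have r3: "3 \<le> r" using r by presburger
  have nz: "\<not> z (b + c - t)" if "t \<in> {1, 2, 3}" for t
  proof (cases "?N \<le> b + c - t")
    case True
    then show ?thesis using odd_r_zeros(2)[of "b + c - t"] that by auto
  next
    case False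
    \<comment> \<open>This happens only for \<open>r = 3\<close> and \<open>t = 3\<close>: the third
      letter from the end is then the closing one of the last long block.\<close>
    then have "b + c - t = q * (b + 1) + b" using N r3 that c_eq by (auto simp: algebra_simps)
    then have "\<not> X_zero (b + c - t)" using X_zero_iff[of "b + c - t" q b] b_gt_1 by simp
    then show ?thesis
      using odd_r_zeros(1)[of "b + c - t"] False that b_less_c b_gt_1 by auto
  qed
  have prior: "\<not> z (d - t)" if "t \<in> {1, 2, 3}" "t \<le> d" for t
  proof -
    have "0 \<le> b + c - t" using that b_gt_1 b_less_c odd_r_less r3 by auto
    then show ?thesis
      using per_d[of "b + c - t"] odd_r_period[of "d - t"] nz[OF that(1)] that(2)
      by (simp add: algebra_simps)
  qed
  have "0 < ?N" using N b_less_c b_gt_1 odd_r_less by simp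
  then have zd: "z d" using per_d[of 0] odd_r_zeros(1)[of 0] X_zero_small[of 0] b_gt_1 by simp
  have dN: "d < ?N" using zd odd_r_zeros(2)[of d] d by force
  have zX: "z n \<longleftrightarrow> X_zero n" if "0 \<le> n" "n \<le> d" for n
    using odd_r_zeros(1)[of n] that dN by simp
  obtain j s where s: "d = j * (b + 1) + s" "0 \<le> s" "s \<le> b" and j': "0 \<le> d \<longrightarrow> 0 \<le> j"
    by (rule X_repr)
  have ev: "even s" "s < b" using X_zero_iff[OF s] zd zX[of d] d by auto
  have j: "0 \<le> j" using j' d by simp
  show False
  proof (cases "s = 0")
    case True
    have "1 \<le> j" using True j s d by (cases "j = 0") auto
    have dj: "d = j * (b + 1)" using s True by simp
    have "b + 1 \<le> d" unfolding dj using \<open>1 \<le> j\<close> b_gt_1 by simp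
    then have "3 \<le> d" using odd_r_less r3 by linarith
    have "d - 3 = (j - 1) * (b + 1) + (b - 2)" using s True by (simp add: algebra_simps)
    then have "X_zero (d - 3)"
      using X_zero_iff[of "d - 3" "j - 1" "b - 2"] even_b b_gt_1 by simp
    then show False using prior[of 3] zX[of "d - 3"] \<open>3 \<le> d\<close> by simp
  next
    case False
    then have "2 \<le> s" using s ev by presburger
    moreover have "0 \<le> j * (b + 1)" using j b_gt_1 by simp
    ultimately have "2 \<le> d" using s by linarith
    have "X_zero (d - 2)"
      using X_zero_iff[of "d - 2" j "s - 2"] s ev \<open>2 \<le> s\<close> by simp
    then show False using prior[of 2] zX[of "d - 2"] \<open>2 \<le> d\<close> by simp
  qed
qed

end

end

section \<open>The blocks $T_i$\<close>

text \<open>The condition \<open>c_gt\<close> excludes \<open>c = b + 1\<close> only for positive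
  \<open>g\<close>: there \<open>q = 1\<close> and \<open>r = 0\<close>, and the first word would
  have no alternating part after its long block. The pair \<open>b = 2\<close>, \<open>c = 3\<close>
  has \<open>g = 0\<close> and is included.\<close>

locale block_game = subtraction_game +
  fixes q r g :: int
  assumes c_eq: "c = q * (b + 1) + r" and b_eq: "b = r + 2 * g + 2"
    and r_nonneg: "0 \<le> r" and even_r: "even r" and g_nonneg: "0 \<le> g" and q_pos: "0 < q"
    and c_gt: "g = 0 \<or> b + 1 < c"
begin

text \<open>The block $T_i$ starts at position $p$, with $g = \gamma$. Its final $011$ is not part of the
  shape except for the zero in the last clause: at that place $P'$, the word for $i = q$, departs
  from the pattern of $T_i$.\<close>

definition shape :: "int \<Rightarrow> int \<Rightarrow> bool" where
  "shape p i \<longleftrightarrow>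
     (\<forall>j s. 0 \<le> j \<longrightarrow> j < q - i \<longrightarrow> 0 \<le> s \<longrightarrow> s \<le> b \<longrightarrow>
        (z (p + j * (b + 1) + s) \<longleftrightarrow> even s \<and> s < b)) \<and>
     (\<forall>j s. 0 \<le> j \<longrightarrow> j < i \<longrightarrow> 0 \<le> s \<longrightarrow> s < b - 1 \<longrightarrow>
        (z (p + (q - i) * (b + 1) + j * (b - 1) + s) \<longleftrightarrow> even s \<and> s < b - 2)) \<and>
     (\<forall>s. 0 \<le> s \<longrightarrow> s < r + 2 * i \<longrightarrow> (z (p + c - r - 2 * i + s) \<longleftrightarrow> even s)) \<and>
     (\<forall>s. 0 \<le> s \<longrightarrow> s \<le> 2 * (g - i) \<longrightarrow> \<not> z (p + c + s)) \<and>
     (\<forall>s. 0 \<le> s \<longrightarrow> s < r + 2 * i \<longrightarrow>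
        (z (p + c + 2 * (g - i) + 1 + s) \<longleftrightarrow> even s)) \<and>
     (z (p + c + b - 1) \<longleftrightarrow> i < q)"

lemma even_b: "even b"
  using b_eq even_r by simp

section \<open>One word T_i from what precedes it\<close>

lemma blockX:
  assumes "0 \<le> n" "\<not> z (n - 1)"
    and "\<And>s. even s \<Longrightarrow> 0 \<le> s \<Longrightarrow> s < b \<Longrightarrow> \<not> z (n + s - b) \<and> \<not> z (n + s - c)"
    and "0 \<le> s" "s \<le> b"
  shows "z (n + s) \<longleftrightarrow> even s \<and> s < b"
proof (cases "s = b")
  case True
  have "z (n + 0)" using alternating[of n b 0] assms b_gt_1 by simp
  then show ?thesis using not_z_add_b[of n] True by simp
next
  case False
  then show ?thesis using alternating[of n b s] assms by simp
qed

text \<open>A short block arises when a zero lies \<open>c\<close> places before the spot where a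
  long block would have its last zero.\<close>

lemma blockY:
  assumes "0 \<le> n" "\<not> z (n - 1)"
    and "\<And>s. even s \<Longrightarrow> 0 \<le> s \<Longrightarrow> s < b - 2 \<Longrightarrow> \<not> z (n + s - b) \<and> \<not> z (n + s - c)"
    and "z (n + b - 2 - c)"
    and "0 \<le> s" "s < b - 1"
  shows "z (n + s) \<longleftrightarrow> even s \<and> s < b - 2"
proof (cases "s = b - 2")
  case True
  then show ?thesis using not_z_add_c[OF assms(4), of "n + s"] by simp
next
  case False
  then show ?thesis using alternating[of n "b - 2" s] assms by simp
qed

text \<open>This isolates what a word needs from positions before \<open>p\<close>. Only the long
  and short blocks and the first alternating part look back by \<open>c\<close> beyond
  \<open>p\<close>, and only the first block looks back by \<open>b\<close> beyond \<open>p\<close>;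
  the run of ones and the second alternating part are determined inside the word. Even offsets
  suffice because these are the ones that must carry zeros, and \<open>H3'\<close> supplies the
  closing ones of the short blocks.\<close>

lemma shape_step:
  assumes p: "0 \<le> p" and i: "0 \<le> i" "i \<le> q" "i \<le> g"
    and H1: "\<not> z (p - 1)"
      "\<And>s. even s \<Longrightarrow> 0 \<le> s \<Longrightarrow> s < b \<Longrightarrow> \<not> z (p - b + s)"
    and H2: "\<And>j s. 0 \<le> j \<Longrightarrow> j < q - i \<Longrightarrow> even s \<Longrightarrow> 0 \<le> s \<Longrightarrow> s < b \<Longrightarrow>
      \<not> z (p + j * (b + 1) + s - c)"
    and H3: "\<And>j s. 0 \<le> j \<Longrightarrow> j < i \<Longrightarrow> even s \<Longrightarrow> 0 \<le> s \<Longrightarrow> s < b - 2 \<Longrightarrow>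
      \<not> z (p + (q - i) * (b + 1) + j * (b - 1) + s - c)"
    and H3': "\<And>j. 0 \<le> j \<Longrightarrow> j < i \<Longrightarrow>
      z (p + (q - i) * (b + 1) + j * (b - 1) + b - 2 - c)"
    and H4: "\<And>s. even s \<Longrightarrow> 0 \<le> s \<Longrightarrow> s < r + 2 * i \<Longrightarrow> \<not> z (p - r - 2 * i + s)"
  shows "shape p i"
proof -
  have X': "j < q - i \<longrightarrow> (\<forall>s. 0 \<le> s \<longrightarrow> s \<le> b \<longrightarrow>
      (z (p + j * (b + 1) + s) \<longleftrightarrow> even s \<and> s < b))" if "0 \<le> j" for j
    using that
  proof (induction j rule: int_ge_induct)
    case base
    show ?case
    proof (intro impI allI)
      fix s assume "0 < q - i" "0 \<le> s" "s \<le> b"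
      then show "z (p + 0 * (b + 1) + s) \<longleftrightarrow> even s \<and> s < b"
        using blockX[of p s] p H1(1) H1(2) H2[of 0] by (simp add: algebra_simps)
    qed
  next
    case (step j)
    show ?case
    proof (intro impI allI)
      fix s assume j: "j + 1 < q - i" and s: "0 \<le> s" "s \<le> b"
      let ?n = "p + (j + 1) * (b + 1)"
      have IH: "z (p + j * (b + 1) + s) \<longleftrightarrow> even s \<and> s < b" if "0 \<le> s" "s \<le> b" for s
        using step.IH j that by simp
      show "z (?n + s) \<longleftrightarrow> even s \<and> s < b"
      proof (rule blockX)
        show "0 \<le> ?n" using p step.hyps b_gt_1 by simp
        show "\<not> z (?n - 1)" using IH[of b] b_gt_1 by (simp add: algebra_simps)
        fix s assume s: "even s" "0 \<le> s" "s < b"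
        show "\<not> z (?n + s - b) \<and> \<not> z (?n + s - c)"
          using IH[of "s + 1"] H2[of "j + 1" s] s step.hyps j by (simp add: algebra_simps)
      qed (use s in auto)
    qed
  qed
  have X: "z n \<longleftrightarrow> even s \<and> s < b"
    if "0 \<le> j" "j < q - i" "0 \<le> s" "s \<le> b" "n = p + j * (b + 1) + s" for j s n
    using X' that by blast
  have Xlast: "\<not> z (p + (q - i) * (b + 1) - 1)"
       "even s \<Longrightarrow> 0 \<le> s \<Longrightarrow> s < b \<Longrightarrow> \<not> z (p + (q - i) * (b + 1) + s - b)" for s
  proof -
    show "\<not> z (p + (q - i) * (b + 1) - 1)"
    proof (cases "i < q")
      case True
      then show ?thesis
        using X[of "q - i - 1" b "p + (q - i) * (b + 1) - 1"] b_gt_1 by (simp add: algebra_simps)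
    qed (use i H1 in simp)
    assume s: "even s" "0 \<le> s" "s < b"
    show "\<not> z (p + (q - i) * (b + 1) + s - b)"
    proof (cases "i < q")
      case True
      then show ?thesis
        using X[of "q - i - 1" "s + 1" "p + (q - i) * (b + 1) + s - b"] s
        by (simp add: algebra_simps)
    qed (use i H1(2)[OF s] in \<open>simp add: algebra_simps\<close>)
  qed
  \<comment> \<open>The letter before each short block is carried through the induction: short
    blocks have length \<open>b - 1\<close>, so looking back by \<open>b\<close> from the start of
    the next one reaches it.\<close>
  have Y': "j < i \<longrightarrow> \<not> z (p + (q - i) * (b + 1) + j * (b - 1) - 1) \<and>
      (\<forall>s. 0 \<le> s \<longrightarrow> s < b - 1 \<longrightarrow>
        (z (p + (q - i) * (b + 1) + j * (b - 1) + s) \<longleftrightarrow> even s \<and> s < b - 2))" if "0 \<le> j" for j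
    using that
  proof (induction j rule: int_ge_induct)
    case base
    show ?case
    proof (intro impI conjI allI)
      let ?n = "p + (q - i) * (b + 1) + 0 * (b - 1)"
      show prev: "\<not> z (?n - 1)" using Xlast(1) by simp
      fix s assume "0 < i" and s: "0 \<le> s" "s < b - 1"
      show "z (?n + s) \<longleftrightarrow> even s \<and> s < b - 2"
      proof (rule blockY)
        show "0 \<le> ?n" using p i b_gt_1 by simp
        show "\<not> z (?n - 1)" by (rule prev)
        show "z (?n + b - 2 - c)" using H3'[of 0] \<open>0 < i\<close> by simp
        fix s assume s: "even s" "0 \<le> s" "s < b - 2"
        show "\<not> z (?n + s - b) \<and> \<not> z (?n + s - c)"
          using Xlast(2)[of s] H3[of 0 s] s \<open>0 < i\<close> by simp
      qed (use s in auto)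
    qed
  next
    case (step j)
    show ?case
    proof (intro impI conjI allI)
      let ?n = "p + (q - i) * (b + 1) + (j + 1) * (b - 1)"
      assume j: "j + 1 < i"
      have IH0: "\<not> z (p + (q - i) * (b + 1) + j * (b - 1) - 1)"
        using step.IH j by simp
      have IH: "z n \<longleftrightarrow> even s \<and> s < b - 2"
        if "0 \<le> s" "s < b - 1" "n = p + (q - i) * (b + 1) + j * (b - 1) + s" for s n
        using step.IH j that by simp
      show prev: "\<not> z (?n - 1)"
        using IH[of "b - 2" "?n - 1"] b_gt_1 by (simp add: algebra_simps)
      fix s assume s: "0 \<le> s" "s < b - 1"
      show "z (?n + s) \<longleftrightarrow> even s \<and> s < b - 2"
      proof (rule blockY)
        show "0 \<le> ?n" using p i b_gt_1 step.hyps by simp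
        show "\<not> z (?n - 1)" by (rule prev)
        show "z (?n + b - 2 - c)" using H3'[of "j + 1"] j step.hyps by simp
        fix s assume s: "even s" "0 \<le> s" "s < b - 2"
        have "\<not> z (?n + s - b)"
        proof (cases "s = 0")
          case True
          then show ?thesis using IH0 by (simp add: algebra_simps)
        next
          case False
          then show ?thesis using IH[of "s - 1" "?n + s - b"] s by (simp add: algebra_simps)
        qed
        then show "\<not> z (?n + s - b) \<and> \<not> z (?n + s - c)"
          using H3[of "j + 1" s] s j step.hyps by simp
      qed (use s in auto)
    qed
  qed
  have Yprev: "\<not> z (p + (q - i) * (b + 1) + j * (b - 1) - 1)" if "0 \<le> j" "j < i" for j
    using Y' that by simp
  have Y: "z n \<longleftrightarrow> even s \<and> s < b - 2"
    if "0 \<le> j" "j < i" "0 \<le> s" "s < b - 1" "n = p + (q - i) * (b + 1) + j * (b - 1) + s" for j s n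
    using Y' that by simp
  let ?C = "p + c - r - 2 * i"
  have Cprev: "\<not> z (?C - 1)"
  proof (cases "i = 0")
    case True
    then show ?thesis using Xlast(1) c_eq by (simp add: algebra_simps)
  next
    case False
    have "?C - 1 = p + (q - i) * (b + 1) + (i - 1) * (b - 1) + (b - 2)"
      using c_eq by (simp add: algebra_simps)
    then show ?thesis using Y[of "i - 1" "b - 2" "?C - 1"] i False b_eq r_nonneg g_nonneg by simp
  qed
  have Cb: "\<not> z (?C + s - b)" if s: "even s" "0 \<le> s" "s \<le> b - 2" for s
  proof (cases "i = 0")
    case True
    then show ?thesis using Xlast(2)[of s] c_eq s by (simp add: algebra_simps)
  next
    case False
    have eq: "?C + s - b = p + (q - i) * (b + 1) + (i - 1) * (b - 1) + (s - 1)"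
      using c_eq by (simp add: algebra_simps)
    show ?thesis
    proof (cases "s = 0")
      case True
      have eq': "?C + s - b = p + (q - i) * (b + 1) + (i - 1) * (b - 1) - 1"
        using eq True by simp
      show ?thesis unfolding eq' using Yprev[of "i - 1"] i False by simp
    next
      case s0: False
      then show ?thesis unfolding eq
        using Y[of "i - 1" "s - 1" "p + (q - i) * (b + 1) + (i - 1) * (b - 1) + (s - 1)"] i False s
        by simp
    qed
  qed
  have C_nonneg: "0 \<le> ?C"
  proof -
    have "?C = p + (q - i) * (b + 1) + i * (b - 1)" using c_eq by (simp add: algebra_simps)
    moreover have "0 \<le> p + (q - i) * (b + 1) + i * (b - 1)" using p i b_gt_1 by simp
    ultimately show ?thesis by (simp only:)
  qed
  have C: "z n \<longleftrightarrow> even s" if "0 \<le> s" "s < r + 2 * i" "n = ?C + s" for s n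
  proof -
    have "z (?C + s) \<longleftrightarrow> even s"
    proof (rule alternating[where m = "r + 2 * i"])
      fix s assume s: "even s" "0 \<le> s" "s < r + 2 * i"
      have "s \<le> b - 2" using s i b_eq by simp
      moreover have eq: "?C + s - c = p - r - 2 * i + s" by simp
      ultimately show "\<not> z (?C + s - b) \<and> \<not> z (?C + s - c)"
        unfolding eq using Cb[of s] H4[of s] s by blast
    qed (use that Cprev C_nonneg in auto)
    then show ?thesis using that by simp
  qed
  \<comment> \<open>The first block is long for \<open>i < q\<close> and short for
    \<open>i = q\<close>; offset \<open>b - 2\<close> carries a zero only in a long one.\<close>
  have first: "z (p + s) \<longleftrightarrow> even s" if "0 \<le> s" "s < b - 2 \<or> s < b \<and> i < q" for s
  proof (cases "i < q")
    case True
    then show ?thesis using X[of 0 s "p + s"] that by auto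
  next
    case False
    then show ?thesis using Y[of 0 s "p + s"] that i q_pos by auto
  qed
  \<comment> \<open>Even offsets of the run are covered by zeros of the first block,
    \<open>c\<close> places back, and odd offsets by zeros of the block just before the first
    alternating part, \<open>b\<close> places back.\<close>
  have D: "\<not> z (p + c + s)" if s: "0 \<le> s" "s \<le> 2 * (g - i)" for s
  proof (cases "even s")
    case True
    have "s < b - 2 \<or> s < b \<and> i < q"
      using s i q_pos b_eq r_nonneg by auto
    then have "z (p + s)" using first[of s] True s by simp
    then show ?thesis using not_z_add_c[of "p + s" "p + c + s"] by simp
  next
    case False
    have le: "r + 2 * i + s - 1 \<le> b - 4" using s False b_eq by presburger
    have "z (p + c + s - b)"
    proof (cases "i = 0")
      case True
      have "p + c + s - b = p + (q - 1) * (b + 1) + (r + s + 1)"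
        using c_eq True by (simp add: algebra_simps)
      then show ?thesis
        using X[of "q - 1" "r + s + 1" "p + c + s - b"] True q_pos False s r_nonneg even_r le by simp
    next
      case i0: False
      have "p + c + s - b = p + (q - i) * (b + 1) + (i - 1) * (b - 1) + (r + 2 * i + s - 1)"
        using c_eq by (simp add: algebra_simps)
      then show ?thesis
        using Y[of "i - 1" "r + 2 * i + s - 1" "p + c + s - b"] i0 i False s r_nonneg even_r le
        by simp
    qed
    then show ?thesis using not_z_add_b[of "p + c + s - b"] by simp
  qed
  let ?E = "p + c + 2 * (g - i) + 1"
  \<comment> \<open>Offset \<open>t\<close> of the second alternating part looks back by
    \<open>b\<close> to offset \<open>t - 1\<close> of the first one, and by \<open>c\<close> to an
    odd offset of the first block. If that block is long, the pattern extends by one more zero,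
    which is the last clause of \<open>shape\<close>.\<close>
  have E: "z (?E + s) \<longleftrightarrow> even s" if s: "0 \<le> s" "s < r + 2 * i \<or> s = r + 2 * i \<and> i < q" for s
  proof (rule alternating[where m = "s + 1"])
    show "\<not> z (?E - 1)" using D[of "2 * (g - i)"] i by simp
    show "0 \<le> ?E" using p b_gt_1 b_less_c i by simp
    fix t assume t: "even t" "0 \<le> t" "t < s + 1"
    have eq: "?E + t - b = ?C + (t - 1)" using b_eq by simp
    have "\<not> z (?E + t - b)"
      unfolding eq using Cprev C[OF _ _ refl, of "t - 1"] t s by (cases "t = 0") auto
    moreover have "?E + t - c = p + (2 * (g - i) + 1 + t)" by simp
    moreover have "\<not> z (p + (2 * (g - i) + 1 + t))"
    proof -
      have "2 * (g - i) + 1 + t < b - 2 \<or> 2 * (g - i) + 1 + t < b \<and> i < q"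
        using s t b_eq even_r i by presburger
      then show ?thesis using first[of "2 * (g - i) + 1 + t"] t i by simp
    qed
    ultimately show "\<not> z (?E + t - b) \<and> \<not> z (?E + t - c)" by metis
  qed (use s in auto)
  have F: "z (p + c + b - 1) \<longleftrightarrow> i < q"
  proof
    assume *: "i < q"
    have eq: "p + c + b - 1 = ?E + (r + 2 * i)" using b_eq by simp
    show "z (p + c + b - 1)" unfolding eq using E[of "r + 2 * i"] even_r r_nonneg i * by simp
  next
    assume *: "z (p + c + b - 1)"
    show "i < q"
    proof (rule ccontr)
      assume "\<not> i < q"
      then have iq: "i = q" using i by simp
      \<comment> \<open>No long block is left, so the second short block starts here, or the first
        alternating part if \<open>q = 1\<close>.\<close>
      have "z (p + b - 1)"
      proof (cases "i = 1")
        case True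
        have "p + b - 1 = ?C" using True iq c_eq by simp
        then show ?thesis using C[of 0 "p + b - 1"] True r_nonneg by simp
      next
        case False
        then show ?thesis using Y[of 1 0 "p + b - 1"] iq q_pos i b_eq r_nonneg by simp
      qed
      then show False using * not_z_add_c[of "p + b - 1"] by (simp add: algebra_simps)
    qed
  qed
  show ?thesis
    unfolding shape_def using X Y C D E F by auto
qed

section \<open>Reading letters off a word, and the passage from T_i to T_{i+1}\<close>

lemma shape_X:
  "shape p i \<Longrightarrow> 0 \<le> j \<Longrightarrow> j < q - i \<Longrightarrow> 0 \<le> s \<Longrightarrow> s \<le> b \<Longrightarrow> n = p + j * (b + 1) + s \<Longrightarrow>
    z n \<longleftrightarrow> even s \<and> s < b"
  unfolding shape_def by simp

lemma shape_Y:
  "shape p i \<Longrightarrow> 0 \<le> j \<Longrightarrow> j < i \<Longrightarrow> 0 \<le> s \<Longrightarrow> s < b - 1 \<Longrightarrow>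
    n = p + (q - i) * (b + 1) + j * (b - 1) + s \<Longrightarrow> z n \<longleftrightarrow> even s \<and> s < b - 2"
  unfolding shape_def by simp

lemma shape_C:
  "shape p i \<Longrightarrow> 0 \<le> s \<Longrightarrow> s < r + 2 * i \<Longrightarrow> n = p + c - r - 2 * i + s \<Longrightarrow> z n \<longleftrightarrow> even s"
  unfolding shape_def by simp

lemma shape_D: "shape p i \<Longrightarrow> 0 \<le> s \<Longrightarrow> s \<le> 2 * (g - i) \<Longrightarrow> n = p + c + s \<Longrightarrow> \<not> z n"
  unfolding shape_def by simp

lemma shape_E:
  "shape p i \<Longrightarrow> 0 \<le> s \<Longrightarrow> s < r + 2 * i \<Longrightarrow> n = p + c + 2 * (g - i) + 1 + s \<Longrightarrow> z n \<longleftrightarrow> even s"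
  unfolding shape_def by simp

lemma shape_F: "shape p i \<Longrightarrow> n = p + c + b - 1 \<Longrightarrow> z n \<longleftrightarrow> i < q"
  unfolding shape_def by simp

text \<open>The second letter is a one because whatever follows the first long block starts with a
  zero \<open>c\<close> places earlier. For \<open>q = 1\<close> and \<open>i = 0\<close> that is
  the first alternating part, of length \<open>r\<close>, which is nonempty by
  \<open>c_gt\<close>.\<close>

lemma shape_tail:
  assumes sh: "shape p i" and i: "0 \<le> i" "i < q" and "0 < g"
  shows "\<not> z (p + c + b)" "\<not> z (p + c + b + 1)"
proof -
  show "\<not> z (p + c + b)"
    using shape_F[OF sh refl] i not_z_add_1[of "p + c + b - 1" "p + c + b"] by simp
  have "z (p + b + 1)"
  proof -
    consider "2 \<le> q - i" | "q - i = 1" "0 < i" | "q = 1" "i = 0" using i by linarith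
    then show ?thesis
    proof cases
      case 1
      then show ?thesis using shape_X[OF sh, of 1 0 "p + b + 1"] b_gt_1 by simp
    next
      case 2
      then show ?thesis
        using shape_Y[OF sh, of 0 0 "p + b + 1"] b_eq r_nonneg \<open>0 < g\<close> by (simp add: algebra_simps)
    next
      case 3
      then show ?thesis using shape_C[OF sh, of 0 "p + b + 1"] c_eq c_gt \<open>0 < g\<close> by simp
    qed
  qed
  then show "\<not> z (p + c + b + 1)" using not_z_add_c[of "p + b + 1"] by (simp add: algebra_simps)
qed

text \<open>All look-backs that leave the initial word reach negative positions.\<close>

lemma shape_0: "shape 0 0"
proof (rule shape_step)
  fix j s assume *: "0 \<le> j" "j < q - 0" "0 \<le> s" "s < b"
  then have "j * (b + 1) \<le> (q - 1) * (b + 1)"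
    using b_gt_1 by (intro mult_right_mono) auto
  then have "0 + j * (b + 1) + s - c < 0" using c_eq r_nonneg * by (simp add: algebra_simps)
  then show "\<not> z (0 + j * (b + 1) + s - c)" by (rule not_z_neg)
qed (use r_nonneg q_pos g_nonneg in \<open>auto intro!: not_z_neg\<close>)

text \<open>Moved back by \<open>c\<close>, long block \<open>j\<close> of the new word meets long
  block \<open>j + 1\<close> of the old one, short block \<open>j\<close> meets short block
  \<open>j\<close>, the additional short block meets the first alternating part and the run of ones,
  and the new first alternating part meets the second one with its tail. Each time the offset grows
  by one, so even offsets meet ones.\<close>

lemma shape_Suc:
  assumes p: "0 \<le> p" and sh: "shape p i" and i: "0 \<le> i" "i < q" "i < g"
  shows "shape (p + (b + c + 2)) (i + 1)"
proof (rule shape_step)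
  let ?p = "p + (b + c + 2)"
  have g: "0 < g" using i by simp
  note tail = shape_tail[OF sh i(1,2) g]
  show "0 \<le> ?p" using p b_gt_1 b_less_c by simp
  show "0 \<le> i + 1" "i + 1 \<le> q" "i + 1 \<le> g" using i by auto
  show "\<not> z (?p - 1)" using tail(2) by (simp add: algebra_simps)
  have E: "\<not> z (p + c + 2 * (g - i) + 1 + s)" if "odd s" "0 \<le> s" "s \<le> r + 2 * i + 1" for s
  proof (cases "s < r + 2 * i")
    case True
    then show ?thesis using shape_E[OF sh, of s "p + c + 2 * (g - i) + 1 + s"] that by simp
  next
    case False
    then have "s = r + 2 * i + 1" using that even_r by presburger
    then have eq: "p + c + 2 * (g - i) + 1 + s = p + c + b" using b_eq by simp
    show ?thesis unfolding eq by (rule tail(1))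
  qed
  show "\<not> z (?p - b + s)" if s: "even s" "0 \<le> s" "s < b" for s
  proof (cases "s + 2 \<le> 2 * (g - i)")
    case True
    then show ?thesis using shape_D[OF sh, of "s + 2" "?p - b + s"] s by simp
  next
    case False
    have eq: "?p - b + s = p + c + 2 * (g - i) + 1 + (s + 1 - 2 * (g - i))" by simp
    have "s + 1 - 2 * (g - i) \<le> r + 2 * i + 1" using s b_eq even_r by presburger
    then show ?thesis using E[of "s + 1 - 2 * (g - i)"] s False unfolding eq by simp
  qed
  show "\<not> z (?p + j * (b + 1) + s - c)"
    if "0 \<le> j" "j < q - (i + 1)" "even s" "0 \<le> s" "s < b" for j s
    using shape_X[OF sh, of "j + 1" "s + 1" "?p + j * (b + 1) + s - c"] that
    by (simp add: algebra_simps)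
  fix j assume j: "0 \<le> j" "j < i + 1"
  let ?m = "?p + (q - (i + 1)) * (b + 1) + j * (b - 1)"
  show "\<not> z (?m + s - c)" if s: "even s" "0 \<le> s" "s < b - 2" for s
  proof (cases "j = i")
    case False
    then show ?thesis
      using shape_Y[OF sh, of j "s + 1" "?m + s - c"] s j by (simp add: algebra_simps)
  next
    case ji: True
    have eq: "?m + s - c = p + c - r - 2 * i + (s + 1)"
      using ji c_eq by (simp add: algebra_simps)
    show ?thesis
    proof (cases "s + 1 < r + 2 * i")
      case True
      then show ?thesis unfolding eq using shape_C[OF sh _ _ refl, of "s + 1"] s by simp
    next
      case False
      have "s + 1 - r - 2 * i \<le> 2 * (g - i)" using s b_eq by simp
      then show ?thesis
        unfolding eq
        using shape_D[OF sh, of "s + 1 - r - 2 * i" "p + c - r - 2 * i + (s + 1)"] s False by simp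
    qed
  qed
  show "z (?m + b - 2 - c)"
  proof (cases "j = i")
    case True
    have "?m + b - 2 - c = p + c + 2 * (g - i) + 1 + 0"
      using True b_eq c_eq by (simp add: algebra_simps)
    \<comment> \<open>For \<open>r = 0\<close> and \<open>i = 0\<close> the second alternating part
      is empty, and the zero required here is the one of the last clause.\<close>
    moreover have "p + c + b - 1 = p + c + 2 * (g - i) + 1 + 0" if "r + 2 * i = 0"
      using that b_eq by simp
    ultimately show ?thesis
      using shape_E[OF sh, of 0 "?m + b - 2 - c"] shape_F[OF sh, of "?m + b - 2 - c"]
        i r_nonneg by fastforce
  next
    case False
    then consider "j + 1 < i" | "j + 1 = i" using j by linarith
    then show ?thesis
    proof cases
      case 1
      then show ?thesis
        using shape_Y[OF sh, of "j + 1" 0 "?m + b - 2 - c"] j b_eq r_nonneg g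
        by (simp add: algebra_simps)
    next
      case 2
      have "?m + b - 2 - c = p + c - r - 2 * i + 0"
        using c_eq unfolding 2[symmetric] by (simp add: algebra_simps)
      then show ?thesis using shape_C[OF sh, of 0 "?m + b - 2 - c"] 2 j r_nonneg by simp
    qed
  qed
next
  fix s assume s: "even s" "0 \<le> s" "s < r + 2 * (i + 1)"
  let ?n = "p + (b + c + 2) - r - 2 * (i + 1) + s"
  have tail: "\<not> z (p + c + b)" using shape_tail[OF sh i(1,2)] i by simp
  show "\<not> z ?n"
  proof (cases "s + 1 < r + 2 * i")
    case True
    then show ?thesis using shape_E[OF sh, of "s + 1" ?n] s b_eq by simp
  next
    case False
    then have "s = r + 2 * i" using s even_r by presburger
    then show ?thesis using tail by (simp add: algebra_simps)
  qed
qed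

lemma shape_mult:
  assumes "0 \<le> i" "i \<le> q" "i \<le> g"
  shows "shape (i * (b + c + 2)) i"
  using assms
proof (induction i rule: int_ge_induct)
  case base
  show ?case using shape_0 by simp
next
  case (step i)
  have "0 \<le> i * (b + c + 2)" using step.hyps b_gt_1 b_less_c by simp
  then have "shape (i * (b + c + 2) + (b + c + 2)) (i + 1)"
    using step by (intro shape_Suc) auto
  then show ?case by (simp add: algebra_simps)
qed

section \<open>The period that sets in after the last word T_i\<close>

lemma shape_cases [consumes 4, case_names X Y C]:
  assumes "0 \<le> i" "i \<le> q" "p \<le> n" "n < p + c"
  obtains j s where "0 \<le> j" "j < q - i" "0 \<le> s" "s \<le> b" "n = p + j * (b + 1) + s"
  | j s where "0 \<le> j" "j < i" "0 \<le> s" "s < b - 1"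
      "n = p + (q - i) * (b + 1) + j * (b - 1) + s"
  | s where "0 \<le> s" "s < r + 2 * i" "n = p + c - r - 2 * i + s"
proof -
  have dm: "m div a * a + m mod a = m" "0 \<le> m div a" "0 \<le> m mod a" "m mod a < a"
    if "0 \<le> m" "0 < a" for m a :: int
    using that by (auto simp: pos_imp_zdiv_nonneg_iff)
  let ?m = "n - p - (q - i) * (b + 1)"
  have C: "p + c - r - 2 * i = p + (q - i) * (b + 1) + i * (b - 1)"
    using c_eq by (simp add: algebra_simps)
  consider "?m < 0" | "0 \<le> ?m" "?m < i * (b - 1)" | "i * (b - 1) \<le> ?m" by linarith
  then show ?thesis
  proof cases
    case 1
    note d = dm[of "n - p" "b + 1"]
    have "(n - p) div (b + 1) * (b + 1) < (q - i) * (b + 1)"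
      using d 1 assms b_gt_1 by linarith
    then have "(n - p) div (b + 1) < q - i" using b_gt_1 by (simp add: mult_less_cancel_right)
    then show ?thesis
      using that(1)[of "(n - p) div (b + 1)" "(n - p) mod (b + 1)"] d assms b_gt_1 by simp
  next
    case 2
    note d = dm[of ?m "b - 1"]
    have "?m div (b - 1) * (b - 1) < i * (b - 1)"
      using d 2 b_gt_1 by linarith
    then have "?m div (b - 1) < i" using b_gt_1 by (simp add: mult_less_cancel_right)
    then show ?thesis
      using that(2)[of "?m div (b - 1)" "?m mod (b - 1)"] d 2 b_gt_1 by simp
  next
    case 3
    then show ?thesis using C[THEN sym] assms C by (intro that(3)[of "?m - i * (b - 1)"]) auto
  qed
qed

lemma shape_C_prev:
  assumes sh: "shape p i" and i: "0 \<le> i" "i \<le> q"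
  shows "\<not> z (p + c - r - 2 * i - 1)"
proof (cases "i = 0")
  case True
  then show ?thesis
    using shape_X[OF sh, of "q - 1" b "p + c - r - 2 * i - 1"] q_pos b_gt_1 c_eq
    by (simp add: algebra_simps)
next
  case False
  then show ?thesis
    using shape_Y[OF sh, of "i - 1" "b - 2" "p + c - r - 2 * i - 1"] i b_gt_1 c_eq
    by (simp add: algebra_simps)
qed

text \<open>The only ones in the window that do not follow a zero close a short block. The place
  \<open>b\<close> after the closing one of block \<open>j\<close> is the start of block
  \<open>j + 2\<close>; at the end of the chain, the first and then the second alternating part take
  the role of that block.\<close>

lemma shape_period_b_plus_c:
  assumes sh: "shape p q" and "0 \<le> p" "q \<le> g" "\<not> z (p - 1)" "p \<le> n"
  shows "z (n + (b + c)) \<longleftrightarrow> z n"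
proof (rule period_b_plus_c[OF assms(2,4)])
  show "\<not> z (p + b + c - 1)" using shape_F[OF sh, of "p + b + c - 1"] by simp
  fix n assume n: "p \<le> n" "n < p + c" "\<not> z n"
  from less_imp_le[OF q_pos] order_refl n(1,2) show "z (n - 1) \<or> z (n + b) \<or> z (n + c) \<or> p \<le> n - b \<and> z (n - b)"
  proof (cases rule: shape_cases)
    case (Y j s)
    show ?thesis
    proof (cases "even s")
      case False
      then have "1 \<le> s" using Y by presburger
      then show ?thesis using shape_Y[OF sh, of j "s - 1" "n - 1"] Y False by auto
    next
      case True
      then have s: "s = b - 2"
        using n(3) shape_Y[OF sh, of j s n] Y by auto
      consider "j + 2 < q" | "j + 2 = q" | "j + 1 = q" using Y by linarith
      then have "z (n + b)"
      proof cases
        case 1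
        then show ?thesis
          using shape_Y[OF sh, of "j + 2" 0 "n + b"] Y s b_eq r_nonneg q_pos \<open>q \<le> g\<close>
          by (simp add: algebra_simps)
      next
        case 2
        then have q: "q = j + 2" by simp
        have "n + b = p + c - r - 2 * q + 0"
          using Y(5) s c_eq by (simp add: q algebra_simps)
        then show ?thesis using shape_C[OF sh, of 0 "n + b"] r_nonneg q_pos by simp
      next
        case 3
        then have q: "q = j + 1" by simp
        have "n + b = p + c + 2 * (g - q) + 1 + 0"
          using Y(5) s c_eq b_eq by (simp add: q algebra_simps)
        then show ?thesis using shape_E[OF sh, of 0 "n + b"] r_nonneg q_pos by simp
      qed
      then show ?thesis by simp
    qed
  next
    case (C s)
    then have "odd s" using shape_C[OF sh, of s n] n(3) by auto
    then have "1 \<le> s" using C by presburger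
    then show ?thesis using shape_C[OF sh, of "s - 1" "n - 1"] C \<open>odd s\<close> by simp
  qed simp
qed (use assms in auto)

text \<open>For \<open>i = g\<close> the first alternating part has length \<open>b - 2\<close> and
  forms a short block with the single one after it, so the period consists of blocks. The one
  closing a long block is caused by the zero that starts it; the one closing a short block stands
  before a zero, which becomes its look-back by \<open>c\<close> one period later.\<close>

lemma shape_period_c_plus_1:
  assumes sh: "shape p g" and "0 \<le> p" "g \<le> q" "\<not> z (p - 1)" "p \<le> n"
  shows "z (n + (c + 1)) \<longleftrightarrow> z n"
proof (rule period_c_plus_1[OF assms(2,4)])
  have r: "r + 2 * g = b - 2" using b_eq by simp
  show "\<not> z (p + c)" using shape_D[OF sh, of 0 "p + c"] by simp
  {
    fix n assume n: "p \<le> n" "n < p + b" "z n"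
    let ?s = "n - p"
    show "\<not> z (n + c + 1 - b)"
    \<comment> \<open>This offset carries a zero only if the first block is short, as the start of
      the next one.\<close>
    proof (cases "?s = b - 1")
      case True
      then have eq: "n + c + 1 - b = p + c" by simp
      show ?thesis unfolding eq by fact
    next
      case False
      have ev: "even ?s"
      proof (cases "g < q")
        case True
        then show ?thesis using shape_X[OF sh, of 0 ?s n] n by auto
      next
        case ge: False
        then show ?thesis using shape_Y[OF sh, of 0 ?s n] n \<open>g \<le> q\<close> q_pos False by auto
      qed
      have eq: "n + c + 1 - b = p + c - r - 2 * g + (?s - 1)" using b_eq by simp
      show ?thesis
      proof (cases "?s = 0")
        case True
        then show ?thesis unfolding eq
          using shape_C_prev[OF sh g_nonneg \<open>g \<le> q\<close>] by simp
      next
        case s: False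
        then show ?thesis
          unfolding eq using shape_C[OF sh _ _ refl, of "?s - 1"] r ev n False by simp
      qed
    qed
  }
  fix n assume n: "p \<le> n" "n < p + c" "\<not> z n"
  from g_nonneg \<open>g \<le> q\<close> n(1,2) show "z (n - 1) \<or> z (n + 1) \<or> p \<le> n - b \<and> z (n - b)"
  proof (cases rule: shape_cases)
    case (X j s)
    show ?thesis
    proof (cases "s = b")
      case True
      then show ?thesis using shape_X[OF sh, of j 0 "n - b"] X b_gt_1 by simp
    next
      case False
      then have "odd s" using shape_X[OF sh, of j s n] X n(3) by auto
      then have "1 \<le> s" using X by presburger
      then show ?thesis using shape_X[OF sh, of j "s - 1" "n - 1"] X \<open>odd s\<close> by simp
    qed
  next
    case (Y j s)
    show ?thesis
    proof (cases "even s")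
      case False
      then have "1 \<le> s" using Y by presburger
      then show ?thesis using shape_Y[OF sh, of j "s - 1" "n - 1"] Y False by auto
    next
      case True
      then have s: "s = b - 2"
        using n(3) shape_Y[OF sh, of j s n] Y by auto
      have "z (n + 1)"
      proof (cases "j + 1 < g")
        case True
        have "0 < b - 2" using True Y b_eq r_nonneg by simp
        moreover have "n + 1 = p + (q - g) * (b + 1) + (j + 1) * (b - 1) + 0"
          using Y s by (simp add: algebra_simps)
        ultimately show ?thesis
          using shape_Y[OF sh, of "j + 1" 0 "n + 1"] True Y by simp
      next
        case False
        then have g: "g = j + 1" using Y by simp
        have "n + 1 = p + c - r - 2 * g + 0"
          using Y(5) s c_eq by (simp add: g algebra_simps)
        then show ?thesis using shape_C[OF sh, of 0 "n + 1"] r_nonneg Y by simp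
      qed
      then show ?thesis by simp
    qed
  next
    case (C s)
    then have "odd s" using shape_C[OF sh, of s n] n(3) by auto
    then have "1 \<le> s" using C by presburger
    then show ?thesis using shape_C[OF sh, of "s - 1" "n - 1"] C \<open>odd s\<close> by simp
  qed
qed (use assms in auto)

end

section \<open>Minimal periods\<close>

context block_game
begin

text \<open>Read cyclically, a long block follows a short one only at the start of the period. A
  zero two places back excludes the inside of blocks, a zero \<open>b + 1\<close> places back
  excludes long blocks after long ones, and a zero \<open>b - 1\<close> places ahead excludes starts
  of short blocks.\<close>

lemma not_period_c_plus_1:
  assumes sh: "shape p g" and p: "0 \<le> p" "g < q" "\<not> z (p - 1)" and d: "0 < d" "d < c + 1"
  shows "\<exists>n\<ge>p. z (n + d) \<noteq> z n"
proof (rule ccontr)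
  assume "\<not> ?thesis"
  then have per_d: "z (n + d) \<longleftrightarrow> z n" if "p \<le> n" for n using that by auto
  have per: "z (n + (c + 1)) \<longleftrightarrow> z n" if "p \<le> n" for n
    using shape_period_c_plus_1[OF sh p(1) _ p(3) that] p by simp
  have z_p: "z p" using shape_X[OF sh, of 0 0 p] p b_gt_1 by simp
  let ?x = "p + d"
  have r: "r + 2 * g = b - 2" using b_eq by simp
  have prior: "\<not> z (?x - t)" if "0 \<le> t" "p \<le> ?x - t" "t \<le> c + 1" "\<not> z (p + c + 1 - t)" for t
    using per[of "?x - t"] per_d[of "p + c + 1 - t"] that by (simp add: algebra_simps)
  have c1: "\<not> z (p + c - 1)"
  \<comment> \<open>For \<open>b = 2\<close> a short block is the single letter 1, and the letter
    before it closes a long block.\<close>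
  proof (cases "b = 2")
    case True
    then have eq: "p + c - 1 = p + c - r - 2 * g - 1" using r by simp
    show ?thesis unfolding eq using shape_C_prev[OF sh g_nonneg] p by simp
  next
    case False
    then show ?thesis
      using shape_C[OF sh, of "b - 3" "p + c - 1"] r b_gt_1 even_b by simp
  qed
  have cb: "\<not> z (p + c - b)"
  proof (cases "g = 0")
    case True
    then show ?thesis
      using shape_X[OF sh, of "q - 1" "b - 1" "p + c - b"] q_pos c_eq b_gt_1 even_b r
      by (simp add: algebra_simps)
  next
    case False
    have "p + c - b = p + (q - g) * (b + 1) + (g - 1) * (b - 1) + (b - 3)"
      using c_eq r by (simp add: algebra_simps)
    then show ?thesis
      using shape_Y[OF sh, of "g - 1" "b - 3" "p + c - b"] False g_nonneg b_eq r_nonneg even_b by simp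
  qed
  have zx: "z ?x" using per_d[of p] z_p by simp
  have x2: "\<not> z (?x - 2)" if "2 \<le> d" using prior[of 2] that c1 b_gt_1 b_less_c by simp
  have xb: "\<not> z (?x - (b + 1))" if "b + 1 \<le> d"
    using prior[of "b + 1"] that cb b_gt_1 b_less_c by simp
  have xb': "\<not> z (?x + b - 1)"
    using per_d[of "p + b - 1"] shape_X[OF sh, of 0 "b - 1" "p + b - 1"] p b_gt_1 even_b
    by (simp add: algebra_simps)
  have "?x \<noteq> p + c" using shape_D[OF sh, of 0 "p + c"] zx by auto
  then have x: "p \<le> ?x" "?x < p + c" using d by auto
  have gq: "g \<le> q" using p by simp
  from g_nonneg gq x show False
  proof (cases rule: shape_cases)
    case (X j s)
    then have s: "even s" "s < b" using shape_X[OF sh, of j s ?x] zx by auto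
    show False
    proof (cases "s = 0")
      case True
      then have j: "1 \<le> j" using X d by (cases "j = 0") auto
      have dj: "d = j * (b + 1)" using X True by simp
      have "b + 1 \<le> d" unfolding dj using j b_gt_1 by simp
      moreover have "z (?x - (b + 1))"
        using shape_X[OF sh, of "j - 1" 0 "?x - (b + 1)"] X True j b_gt_1
        by (simp add: algebra_simps)
      ultimately show False using xb by simp
    next
      case False
      then have "2 \<le> s" using s X by presburger
      have d2: "d - 2 = j * (b + 1) + (s - 2)" using X by simp
      have "0 \<le> d - 2" unfolding d2 using X b_gt_1 \<open>2 \<le> s\<close> by simp
      then have "2 \<le> d" by simp
      moreover have x2': "?x - 2 = p + j * (b + 1) + (s - 2)" using X by simp
      have "z (?x - 2)"
        unfolding x2' using shape_X[OF sh _ _ _ _ refl, of j "s - 2"] X s \<open>2 \<le> s\<close> by simp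
      ultimately show False using x2 by simp
    qed
  next
    case (Y j s)
    then have s: "even s" "s < b - 2" using shape_Y[OF sh, of j s ?x] zx by auto
    show False
    proof (cases "s = 0")
      case True
      have "z (?x + b - 1)"
      proof (cases "j + 1 < g")
        case True
        have x: "?x + b - 1 = p + (q - g) * (b + 1) + (j + 1) * (b - 1) + 0"
          using Y \<open>s = 0\<close> by (simp add: algebra_simps)
        show ?thesis
          unfolding x using shape_Y[OF sh _ _ _ _ refl, of "j + 1" 0] True Y s by simp
      next
        case False
        then have g: "g = j + 1" using Y by simp
        have x: "?x + b - 1 = p + c - r - 2 * g + 0"
          using Y(5) \<open>s = 0\<close> c_eq by (simp add: g algebra_simps)
        show ?thesis unfolding x using shape_C[OF sh _ _ refl, of 0] r s Y by simp
      qed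
      then show False using xb' by simp
    next
      case False
      then have s2: "2 \<le> s" using s Y by presburger
      have d2: "d - 2 = (q - g) * (b + 1) + j * (b - 1) + (s - 2)" using Y by simp
      have "0 \<le> d - 2" unfolding d2 using Y b_gt_1 p s2 by simp
      then have "2 \<le> d" by simp
      moreover have x2': "?x - 2 = p + (q - g) * (b + 1) + j * (b - 1) + (s - 2)"
        using Y by simp
      have "z (?x - 2)"
        unfolding x2' using shape_Y[OF sh _ _ _ _ refl, of j "s - 2"] Y s s2 by simp
      ultimately show False using x2 by simp
    qed
  next
    case (C s)
    then have s: "even s" using shape_C[OF sh, of s ?x] zx by auto
    show False
    proof (cases "s = 0")
      case True
      \<comment> \<open>\<open>b - 1\<close> places after the start of the last short block the next
        period begins.\<close>
      have x: "?x + b - 1 = p + (c + 1)" using C True r by simp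
      show False using per[of p] z_p xb' unfolding x by simp
    next
      case False
      then have s2: "2 \<le> s" using s C by presburger
      have d2: "d - 2 = (q - g) * (b + 1) + g * (b - 1) + (s - 2)"
        using C c_eq by (simp add: algebra_simps)
      have "0 \<le> d - 2" unfolding d2 using g_nonneg b_gt_1 p s2 by simp
      then have "2 \<le> d" by simp
      moreover have x2': "?x - 2 = p + c - r - 2 * g + (s - 2)" using C by simp
      have "z (?x - 2)"
        unfolding x2' using shape_C[OF sh _ _ refl, of "s - 2"] C s s2 by simp
      ultimately show False using x2 by simp
    qed
  qed
qed

text \<open>Since \<open>q < g\<close>, the run of ones has length at least three, and no other zero
  of the period is preceded by three ones. The comparison therefore starts from the zero after the
  run rather than from \<open>p\<close>.\<close>

lemma not_period_b_plus_c:
  assumes sh: "shape p q" and p: "0 \<le> p" "q < g" "\<not> z (p - 1)" and d: "0 < d" "d < b + c"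
  shows "\<exists>n\<ge>p. z (n + d) \<noteq> z n"
proof (rule ccontr)
  assume "\<not> ?thesis"
  then have per_d: "z (n + d) \<longleftrightarrow> z n" if "p \<le> n" for n using that by auto
  have per: "z (n + (b + c)) \<longleftrightarrow> z n" if "p \<le> n" for n
    using shape_period_b_plus_c[OF sh p(1) _ p(3) that] p by simp
  let ?E = "p + c + 2 * (g - q) + 1"
  let ?x = "?E + d"
  have b4: "4 \<le> b" using b_eq r_nonneg p q_pos by simp
  have pE: "p \<le> ?E - 3" using p b_less_c b_gt_1 by simp
  have zx: "z ?x" using per_d[of ?E] shape_E[OF sh, of 0 ?E] r_nonneg q_pos pE by simp
  have prior: "\<not> z (?x - t)" if "t \<in> {1, 2, 3}" for t
    using per_d[of "?E - t"] shape_D[OF sh, of "2 * (g - q) + 1 - t" "?E - t"] that p pE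
    by (auto simp: algebra_simps)
  show False
  proof (cases "?x < p + b + c")
    case True
    then have "d \<noteq> r + 2 * q" using zx shape_F[OF sh, of ?x] b_eq by auto
    then have dr: "d < r + 2 * q" using True b_eq by simp
    then have "even d" using shape_E[OF sh, of d ?x] d zx by simp
    then have "2 \<le> d" using d by presburger
    then show False using shape_E[OF sh, of "d - 2" "?x - 2"] dr \<open>even d\<close> prior[of 2] by simp
  next
    case False
    let ?y = "?x - (b + c)"
    have y: "p \<le> ?y" using False by simp
    have zy: "z ?y" using per[OF y] zx by (simp only: diff_add_cancel)
    have prior_y: "\<not> z (?y - t)" if "t \<in> {1, 2, 3}" "p \<le> ?y - t" for t
      using per[of "?y - t"] prior[OF that(1)] that(2) by (simp add: algebra_simps)
    \<comment> \<open>The period ends in 011, so three places before the next one there is a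
      zero.\<close>
    have yp: "?y \<noteq> p"
    proof
      assume eq: "?y = p"
      have "?x - 3 = ?E + (r + 2 * q - 2)" using eq b_eq by simp
      then have "z (?x - 3)"
        using shape_E[OF sh, of "r + 2 * q - 2" "?x - 3"] r_nonneg q_pos even_r by simp
      then show False using prior[of 3] by simp
    qed
    have "?y < p + c"
    proof (rule ccontr)
      assume "\<not> ?y < p + c"
      then show False
        using shape_D[OF sh, of "?y - p - c" ?y] zy d p by simp
    qed
    from less_imp_le[OF q_pos] order_refl y this show False
    proof (cases rule: shape_cases)
      case (Y j s)
      then have s: "even s" "s < b - 2" using shape_Y[OF sh, of j s ?y] zy by auto
      have nn: "0 \<le> j * (b - 1)" using Y b_gt_1 by simp
      show False
      proof (cases "s = 0")
        case True
        then have j: "1 \<le> j" using Y yp by (cases "j = 0") auto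
        have yj: "?y - p = j * (b - 1)" using Y True by simp
        have "b - 1 \<le> ?y - p" unfolding yj using j b_gt_1 by simp
        then have "p \<le> ?y - 3" using b4 by linarith
        moreover have y3: "?y - 3 = p + (q - q) * (b + 1) + (j - 1) * (b - 1) + (b - 4)"
          using Y True by (simp add: algebra_simps)
        have "z (?y - 3)"
          unfolding y3 using shape_Y[OF sh _ _ _ _ refl, of "j - 1" "b - 4"] Y j b4 even_b by simp
        ultimately show False using prior_y[of 3] by simp
      next
        case False
        then have s2: "2 \<le> s" using s Y by presburger
        have y2: "?y - 2 = p + (q - q) * (b + 1) + j * (b - 1) + (s - 2)" using Y by simp
        have "p \<le> ?y - 2" unfolding y2 using nn s2 by simp
        moreover have "z (?y - 2)"
          unfolding y2 using shape_Y[OF sh _ _ _ _ refl, of j "s - 2"] Y s s2 by simp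
        ultimately show False using prior_y[of 2] by simp
      qed
    next
      case (C s)
      then have s: "even s" using shape_C[OF sh, of s ?y] zy by auto
      have C_eq: "c - r - 2 * q = q * (b - 1)" using c_eq by (simp add: algebra_simps)
      have "b - 1 \<le> c - r - 2 * q" unfolding C_eq using b_gt_1 q_pos by simp
      then have p3: "p \<le> p + c - r - 2 * q - 3" using b4 by simp
      show False
      proof (cases "s = 0")
        case True
        then have y3: "?y - 3 = p + (q - q) * (b + 1) + (q - 1) * (b - 1) + (b - 4)"
          using C c_eq by (simp add: algebra_simps)
        have "z (?y - 3)"
          unfolding y3 using shape_Y[OF sh _ _ _ _ refl, of "q - 1" "b - 4"] q_pos b4 even_b by simp
        then show False using prior_y[of 3] p3 C True by simp
      next
        case False
        then have s2: "2 \<le> s" using s C by presburger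
        have y2: "?y - 2 = p + c - r - 2 * q + (s - 2)" using C by simp
        have "z (?y - 2)" unfolding y2 using shape_C[OF sh _ _ refl, of "s - 2"] C s s2 by simp
        then show False using prior_y[of 2] p3 C by simp
      qed
    qed simp
  qed
qed

text \<open>With \<open>q = g\<close> no long block is left; block number \<open>g\<close> is the
  first alternating part, of length \<open>b - 2\<close>, together with the one at
  \<open>p + c\<close>.\<close>

lemma shape_blocks_Y:
  assumes sh: "shape p g" and "q = g" and j: "0 \<le> j" "j \<le> g"
    and s: "0 \<le> s" "s < b - 1" and n: "n = p + j * (b - 1) + s"
  shows "z n \<longleftrightarrow> even s \<and> s < b - 2"
proof (cases "j = g")
  case False
  then show ?thesis using shape_Y[OF sh, of j s n] assms by simp
next
  case True
  have eq: "n = p + c - r - 2 * g + s"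
    using n c_eq True \<open>q = g\<close> by (simp add: algebra_simps)
  show ?thesis
  proof (cases "s = b - 2")
    case True
    then show ?thesis using shape_D[OF sh, of 0 n] eq b_eq by simp
  next
    case False
    then show ?thesis using shape_C[OF sh, of s n] eq s b_eq by auto
  qed
qed

text \<open>The period \<open>c + 1\<close> is filled by exactly \<open>g + 1\<close> short blocks.
  Moving by \<open>b - 1\<close> passes from each block to the next, and from the last one to the
  first block of the following period.\<close>

lemma period_b_minus_1:
  assumes sh: "shape p g" and p: "0 \<le> p" "q = g" "\<not> z (p - 1)" and "p \<le> n"
  shows "z (n + (b - 1)) \<longleftrightarrow> z n"
  using \<open>p \<le> n\<close>
proof (induction "nat (n - p)" arbitrary: n rule: less_induct)
  case less
  have per: "z (n + (c + 1)) \<longleftrightarrow> z n" if "p \<le> n" for n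
    using shape_period_c_plus_1[OF sh p(1) _ p(3) that] p by simp
  have c1: "c + 1 = (g + 1) * (b - 1)" using c_eq p b_eq by (simp add: algebra_simps)
  show ?case
  proof (cases "n < p + (c + 1)")
    case True
    define j s where "j = (n - p) div (b - 1)" and "s = (n - p) mod (b - 1)"
    have js: "n = p + j * (b - 1) + s" "0 \<le> s" "s < b - 1" "0 \<le> j"
      unfolding j_def s_def using less.prems b_gt_1 div_mult_mod_eq[of "n - p" "b - 1"]
      by (auto simp: pos_imp_zdiv_nonneg_iff)
    have "j * (b - 1) < (g + 1) * (b - 1)" using js True c1 by linarith
    then have jg: "j < g + 1" using b_gt_1 by (simp add: mult_less_cancel_right)
    have zn: "z n \<longleftrightarrow> even s \<and> s < b - 2"
      using shape_blocks_Y[OF sh p(2), of j s n] js jg by simp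
    show ?thesis
    proof (cases "j = g")
      case False
      have "n + (b - 1) = p + (j + 1) * (b - 1) + s" using js by (simp add: algebra_simps)
      then show ?thesis
        using shape_blocks_Y[OF sh p(2), of "j + 1" s "n + (b - 1)"] js jg False zn by simp
    next
      case True
      have eq: "n + (b - 1) = p + s + (c + 1)" using js True c1 by (simp add: algebra_simps)
      show ?thesis
        unfolding eq using per[of "p + s"] shape_blocks_Y[OF sh p(2), of 0 s "p + s"] js g_nonneg zn by simp
    qed
  next
    case False
    let ?m = "n - (c + 1)"
    have "z (?m + (b - 1)) \<longleftrightarrow> z ?m"
      by (rule less.hyps) (use False b_gt_1 b_less_c in auto)
    then show ?thesis
      using per[of ?m] per[of "?m + (b - 1)"] False b_gt_1 by (simp add: algebra_simps)
  qed
qed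

lemma not_period_b_minus_1:
  assumes sh: "shape p g" and p: "0 \<le> p" "q = g" "\<not> z (p - 1)" and d: "0 < d" "d < b - 1"
  shows "\<exists>n\<ge>p. z (n + d) \<noteq> z n"
proof (rule ccontr)
  assume "\<not> ?thesis"
  then have per_d: "z (n + d) \<longleftrightarrow> z n" if "p \<le> n" for n using that by auto
  have b4: "4 \<le> b" using b_eq r_nonneg p q_pos by simp
  note Y = shape_blocks_Y[OF sh p(2), of 0]
  have "z p" using Y[of 0 p] g_nonneg b4 by simp
  then have "even d" "d < b - 2" using per_d[of p] Y[of d "p + d"] g_nonneg d by auto
  then have "2 \<le> d" using d by presburger
  then have "z (p + d - 2)"
    using Y[of "d - 2" "p + d - 2"] g_nonneg d \<open>even d\<close> \<open>d < b - 2\<close> by simp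
  then have "z (p + (d - 2) + (b - 1))"
    using period_b_minus_1[OF sh p, of "p + (d - 2)"] \<open>2 \<le> d\<close> by (simp add: algebra_simps)
  then have "z (p + (b - 3) + d)" by (simp add: algebra_simps)
  then have "z (p + (b - 3))" using per_d[of "p + (b - 3)"] b4 by simp
  then show False using Y[of "b - 3" "p + (b - 3)"] g_nonneg b4 even_b by simp
qed

end

section \<open>Words, periods and preperiods\<close>

lemma word_pow_simps [simp]: "X \<up> 0 = []" "X \<up> Suc m = X @ X \<up> m"
  by (simp_all add: word_pow_def)

lemma length_word_pow [simp]: "length (X \<up> m) = m * length X"
  by (induction m) auto

lemma word_pow_add: "X \<up> (m + n) = X \<up> m @ X \<up> n"
  by (induction m) auto

definition occurs :: "(int \<Rightarrow> 'a) \<Rightarrow> int \<Rightarrow> 'a list \<Rightarrow> bool" where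
  "occurs f n U \<longleftrightarrow> (\<forall>j<length U. f (n + int j) = U ! j)"

lemma occurs_Nil [simp]: "occurs f n []"
  by (simp add: occurs_def)

lemma occurs_single [simp]: "occurs f n [x] \<longleftrightarrow> f n = x"
  by (simp add: occurs_def)

lemma occurs_append:
  "occurs f n (U @ V) \<longleftrightarrow> occurs f n U \<and> occurs f (n + int (length U)) V"
proof
  assume *: "occurs f n (U @ V)"
  have "f (n + int (length U) + int j) = V ! j" if "j < length V" for j
    using *[unfolded occurs_def, rule_format, of "length U + j"] that
    by (simp add: add.assoc)
  moreover have "f (n + int j) = U ! j" if "j < length U" for j
    using *[unfolded occurs_def, rule_format, of j] that by (simp add: nth_append)
  ultimately show "occurs f n U \<and> occurs f (n + int (length U)) V"
    by (simp add: occurs_def)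
next
  assume *: "occurs f n U \<and> occurs f (n + int (length U)) V"
  show "occurs f n (U @ V)"
    unfolding occurs_def
  proof (intro allI impI)
    fix j assume "j < length (U @ V)"
    then show "f (n + int j) = (U @ V) ! j"
      using conjunct1[OF *, unfolded occurs_def, rule_format, of j]
        conjunct2[OF *, unfolded occurs_def, rule_format, of "j - length U"]
      by (cases "j < length U") (auto simp: nth_append)
  qed
qed

lemma occurs_pow:
  assumes "\<And>j. j < m \<Longrightarrow> occurs f (n + int j * int (length X)) X"
  shows "occurs f n (X \<up> m)"
  using assms
proof (induction m arbitrary: n)
  case (Suc m)
  have "occurs f (n + int (length X)) (X \<up> m)"
  proof (rule Suc.IH)
    fix j assume "j < m"
    then show "occurs f (n + int (length X) + int j * int (length X)) X"
      using Suc.prems[of "Suc j"] by (simp add: algebra_simps)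
  qed
  then show ?case using Suc.prems[of 0] by (simp add: occurs_append)
qed simp

lemma occurs_concat:
  assumes "\<And>i. i < m \<Longrightarrow> occurs f (int (i * l)) (T i) \<and> length (T i) = l"
  shows "occurs f 0 (concat (map T [0..<m])) \<and> length (concat (map T [0..<m])) = m * l"
  using assms by (induction m) (auto simp: occurs_append)

lemma occurs_alternating:
  assumes "\<And>n. f n \<in> {0, 1 :: int}"
    and "\<And>s. 0 \<le> s \<Longrightarrow> s < 2 * int m \<Longrightarrow> f (n + s) = 0 \<longleftrightarrow> even s"
  shows "occurs f n ([0, 1] \<up> m)"
proof (rule occurs_pow)
  fix j assume "j < m"
  then show "occurs f (n + int j * int (length [0, 1 :: int])) [0, 1]"
    using assms(2)[of "2 * int j"] assms(2)[of "2 * int j + 1"] assms(1)[of "n + (2 * int j + 1)"]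
    by (auto simp: occurs_def less_Suc_eq algebra_simps)
qed

lemma occurs_ones:
  assumes "\<And>n. f n \<in> {0, 1 :: int}"
    and "\<And>s. 0 \<le> s \<Longrightarrow> s < int m \<Longrightarrow> f (n + s) \<noteq> 0"
  shows "occurs f n ([1] \<up> m)"
proof (rule occurs_pow)
  fix j assume "j < m"
  then show "occurs f (n + int j * int (length [1 :: int])) [1]"
    using assms(2)[of "int j"] assms(1)[of "n + int j"] by auto
qed

lemma occurs_block:
  assumes binary: "\<And>n. f n \<in> {0, 1 :: int}"
    and zeros: "\<And>s. 0 \<le> s \<Longrightarrow> s \<le> 2 * int m \<Longrightarrow> f (n + s) = 0 \<longleftrightarrow> even s \<and> s < 2 * int m"
  shows "occurs f n ([0, 1] \<up> m @ [1])"
proof -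
  have "occurs f n ([0, 1] \<up> m)"
    by (rule occurs_alternating[OF binary]) (use zeros in auto)
  moreover have "f (n + 2 * int m) = 1"
    using zeros[of "2 * int m"] binary[of "n + 2 * int m"] by auto
  ultimately show ?thesis by (simp add: occurs_append mult.commute)
qed

lemma wword_eq_conc_iter:
  assumes U: "occurs (wseq A) 0 U" and V: "occurs (wseq A) (int (length U)) V" and "V \<noteq> []"
    and per: "\<And>n. int (length U) \<le> n \<Longrightarrow> wseq A (n + int (length V)) = wseq A n"
  shows "wword A = U \<frown> V\<^sup>\<omega>"
proof
  fix n
  show "wword A n = (U \<frown> V\<^sup>\<omega>) n"
  proof (cases "n < length U")
    case True
    then show ?thesis using U by (simp add: occurs_def wword_def conc_def)
  next
    case False
    have "0 < length V" using \<open>V \<noteq> []\<close> by simp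
    have "wseq A (int (length U + m)) = V ! (m mod length V)" for m
    proof (induction m rule: less_induct)
      case (less m)
      show ?case
      proof (cases "m < length V")
        case True
        then show ?thesis using V by (simp add: occurs_def)
      next
        case ge: False
        have "wseq A (int (length U + m)) = wseq A (int (length U + (m - length V)) + int (length V))"
          using ge by simp
        also have "\<dots> = wseq A (int (length U + (m - length V)))"
          by (rule per) simp
        also have "\<dots> = V ! ((m - length V) mod length V)"
          using ge \<open>0 < length V\<close> by (intro less) linarith
        finally show ?thesis using ge by (simp add: le_mod_geq)
      qed
    qed
    from this[of "n - length U"] False \<open>V \<noteq> []\<close> show ?thesis
      by (simp add: wword_def conc_def iter_def)
  qed
qed

lemma wword_eq_iter:
  assumes "occurs (wseq A) 0 V" "V \<noteq> []"
    and "\<And>n. 0 \<le> n \<Longrightarrow> wseq A (n + int (length V)) = wseq A n"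
  shows "wword A = V\<^sup>\<omega>"
  using wword_eq_conc_iter[of A "[]" V] assms by simp

text \<open>A failure of \<open>d\<close> at one position \<open>n\<close> recurs at all translates
  of \<open>n\<close> by multiples of \<open>p\<close>, so it contradicts even eventual periodicity
  with \<open>d\<close>.\<close>

lemma per_eqI:
  fixes p :: nat and N :: int
  assumes "1 \<le> p" and per: "\<And>n. N \<le> n \<Longrightarrow> wseq A (n + int p) = wseq A n"
    and minimal: "\<And>d. 0 < d \<Longrightarrow> d < int p \<Longrightarrow> \<exists>n\<ge>N. wseq A (n + d) \<noteq> wseq A n"
  shows "per A = p"
  unfolding per_def
proof (rule Least_equality, intro conjI)
  show "1 \<le> p" by fact
  show "\<forall>\<^sub>F n in sequentially. wseq A (int n) = wseq A (int n + int p)"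
    unfolding eventually_sequentially using per by (intro exI[of _ "nat N"]) auto
  fix d assume d: "1 \<le> d \<and> (\<forall>\<^sub>F n in sequentially. wseq A (int n) = wseq A (int n + int d))"
  then obtain M where M: "wseq A (int n + int d) = wseq A (int n)" if "M \<le> n" for n
    unfolding eventually_sequentially by metis
  show "p \<le> d"
  proof (rule ccontr)
    assume "\<not> p \<le> d"
    then obtain n where n: "N \<le> n" "wseq A (n + int d) \<noteq> wseq A n"
      using minimal[of "int d"] d by auto
    have shift: "wseq A (m + int j * int p) = wseq A m" if "N \<le> m" for m j
    proof (induction j)
      case (Suc j)
      have "wseq A (m + int j * int p + int p) = wseq A (m + int j * int p)"
        using that by (intro per) (simp add: add_increasing2)
      then show ?case using Suc by (simp add: algebra_simps)
    qed simp
    \<comment> \<open>As \<open>N\<close> is an integer, \<open>n\<close> may be negative; the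
      absolute value compensates for that, and \<open>p\<close> is at least 1.\<close>
    define j where "j = M + nat \<bar>n\<bar>"
    have "int j * 1 \<le> int j * int p" using \<open>1 \<le> p\<close> by (intro mult_left_mono) auto
    moreover have "int M + \<bar>n\<bar> = int j" unfolding j_def by simp
    ultimately have "int M \<le> n + int j * int p" by linarith
    then have "wseq A (n + int j * int p + int d) = wseq A (n + int j * int p)"
      using M[of "nat (n + int j * int p)"] by simp
    then show False
      using shift[of n j] shift[of "n + int d" j] n by (simp add: algebra_simps)
  qed
qed

lemma preper_eqI:
  assumes "per A = p" and per: "\<And>n. int N \<le> n \<Longrightarrow> wseq A (n + int p) = wseq A n"
    and "N = 0 \<or> wseq A (int N - 1 + int p) \<noteq> wseq A (int N - 1)"
  shows "preper A = N"
  unfolding preper_def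
proof (rule Least_equality)
  show "\<forall>n\<ge>N. wseq A (int n) = wseq A (int n + int (per A))"
    using per assms(1) by simp
  fix M assume M: "\<forall>n\<ge>M. wseq A (int n) = wseq A (int n + int (per A))"
  show "N \<le> M"
  proof (rule ccontr)
    assume "\<not> N \<le> M"
    then show False using M[rule_format, of "N - 1"] assms(1,3) by (simp add: of_nat_diff)
  qed
qed

section \<open>The zeros for a three-element set as an instance of the game\<close>

context
  fixes b c :: nat and A :: "nat set"
  assumes b: "1 < b" and bc: "b < c" and A: "A = {1, b, c}"
begin

lemma wseq_three:
  assumes "0 \<le> n"
  shows "wseq A n = 1 - min (wseq A (n - 1)) (min (wseq A (n - int b)) (wseq A (n - int c)))"
proof -
  have "{wseq A (n - int x) | x. x \<in> A} = (\<lambda>x. wseq A (n - int x)) ` A"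
    by (rule Setcompr_eq_image)
  also have "\<dots> = {wseq A (n - 1), wseq A (n - int b), wseq A (n - int c)}"
    unfolding A by simp
  finally have "{wseq A (n - int x) | x. x \<in> A} =
    {wseq A (n - 1), wseq A (n - int b), wseq A (n - int c)}" .
  moreover have "0 < x" if "x \<in> A" for x using that A b bc by auto
  ultimately show ?thesis using wseq_unfold[of A n] assms by simp
qed

lemma wseq_binary: "wseq A n \<in> {0, 1}"
proof (induction "nat (n + 1)" arbitrary: n rule: less_induct)
  case less
  show ?case
  proof (cases "n < 0")
    case True
    then show ?thesis by (simp add: wseq.simps)
  next
    case False
    then have "wseq A (n - 1) \<in> {0, 1}" "wseq A (n - int b) \<in> {0, 1}" "wseq A (n - int c) \<in> {0, 1}"
      using less b bc by auto
    then show ?thesis using wseq_three[of n] False by auto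
  qed
qed

lemma wseq_game: "subtraction_game (\<lambda>n. wseq A n = 0) (int b) (int c)"
proof
  fix n
  show "wseq A n = 0 \<longleftrightarrow>
    0 \<le> n \<and> wseq A (n - 1) \<noteq> 0 \<and> wseq A (n - int b) \<noteq> 0 \<and> wseq A (n - int c) \<noteq> 0"
  proof (cases "n < 0")
    case True
    then show ?thesis by (simp add: wseq.simps)
  next
    case False
    then show ?thesis
      using wseq_three[of n] wseq_binary[of "n - 1"] wseq_binary[of "n - int b"]
        wseq_binary[of "n - int c"] by auto
  qed
qed (use b bc in auto)

lemma wseq_eq_iff: "wseq A m = wseq A n \<longleftrightarrow> (wseq A m = 0 \<longleftrightarrow> wseq A n = 0)"
  using wseq_binary[of m] wseq_binary[of n] by auto

lemma purely_periodic:
  fixes p :: nat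
  assumes "occurs (wseq A) 0 V" "length V = p" "1 \<le> p"
    and per: "\<And>n. 0 \<le> n \<Longrightarrow> wseq A (n + int p) = 0 \<longleftrightarrow> wseq A n = 0"
    and minimal: "\<And>d. 0 < d \<Longrightarrow> d < int p \<Longrightarrow> \<exists>n\<ge>0. (wseq A (n + d) = 0) \<noteq> (wseq A n = 0)"
  shows "per A = p \<and> preper A = 0 \<and> wword A = V\<^sup>\<omega>"
proof -
  have per': "wseq A (n + int p) = wseq A n" if "0 \<le> n" for n
    using per[OF that] by (subst wseq_eq_iff)
  have "\<exists>n\<ge>0. wseq A (n + d) \<noteq> wseq A n" if "0 < d" "d < int p" for d
    using minimal[OF that] by metis
  then have "per A = p"
    using assms(3) per' by (intro per_eqI[where N = 0]) auto
  moreover have "preper A = 0"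
    using per' \<open>per A = p\<close> by (intro preper_eqI[where p = p]) auto
  moreover have "wword A = V\<^sup>\<omega>"
    using assms(1-3) per' by (intro wword_eq_iter) auto
  ultimately show ?thesis by simp
qed

end

section \<open>The end of the preperiod, and the words read off the blocks\<close>

context block_game
begin

text \<open>The second alternating part and the final 011 together are (01)^{r/2+i+1} 1, which is
  the end of T_i because k-(\<gamma>-i) = r/2+i+1.\<close>

lemma shape_E_tail:
  assumes sh: "shape p i" and i: "0 \<le> i" "i < q" "i < g"
    and s: "0 \<le> s" "s \<le> r + 2 * i + 2" and n: "n = p + c + 2 * (g - i) + 1 + s"
  shows "z n \<longleftrightarrow> even s \<and> s < r + 2 * i + 2"
proof -
  have tail: "\<not> z (p + c + b)" "\<not> z (p + c + b + 1)"
    using shape_tail[OF sh i(1,2)] i by auto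
  consider "s < r + 2 * i" | "s = r + 2 * i" | "s = r + 2 * i + 1" | "s = r + 2 * i + 2"
    using s by linarith
  then show ?thesis
  proof cases
    case 1
    then show ?thesis using shape_E[OF sh, of s n] s n by simp
  next
    case 2
    then show ?thesis using shape_F[OF sh, of n] n b_eq even_r i by simp
  next
    case 3
    then have eq: "n = p + c + b" using n b_eq by simp
    show ?thesis unfolding eq using tail 3 even_r by simp
  next
    case 4
    then have eq: "n = p + c + b + 1" using n b_eq by simp
    show ?thesis unfolding eq using tail 4 by simp
  qed
qed

text \<open>The last T_i has a run of exactly three ones, starting at \<open>p + c\<close>. Moved by
  \<open>c + 1\<close>, the run meets the final 011 of a short block, so its first letter fails and
  the other two agree; afterwards both sides read an alternating stretch of length
  \<open>b - 2\<close> and a one.\<close>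

lemma preperiod_c_plus_1:
  assumes sh: "shape p i" and sh': "shape (p + (b + c + 2)) (i + 1)"
    and i: "0 \<le> i" "i + 1 = g" "g \<le> q"
  shows "1 \<le> t \<Longrightarrow> t \<le> b + 1 \<Longrightarrow> z (p + c + t + (c + 1)) \<longleftrightarrow> z (p + c + t)"
    and "z (p + c + (c + 1)) \<noteq> z (p + c)"
proof -
  let ?P = "p + (b + c + 2)"
  have b4: "4 \<le> b" using b_eq r_nonneg i by simp
  have r: "r + 2 * i + 2 = b - 2" using b_eq i by simp
  have C: "z (?P + c - r - 2 * (i + 1) - 2 + u) \<longleftrightarrow> u = - 1" if "u \<in> {- 1, 0, 1}" for u
  proof -
    have eq: "?P + c - r - 2 * (i + 1) - 2 + u =
      ?P + (q - (i + 1)) * (b + 1) + (g - 1) * (b - 1) + (b - 3 + u)"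
      using c_eq i(2)[symmetric] by (simp add: algebra_simps)
    show ?thesis
      unfolding eq using shape_Y[OF sh' _ _ _ _ refl, of "g - 1" "b - 3 + u"] b4 even_b i that
      by auto
  qed
  have P: "?P + c - r - 2 * (i + 1) = p + c + (c + 1) + 3" using r by simp
  have eq: "p + c + (c + 1) = ?P + c - r - 2 * (i + 1) - 2 + - 1" using P by simp
  show "z (p + c + (c + 1)) \<noteq> z (p + c)"
    unfolding eq using C[of "- 1"] shape_D[OF sh, of 0 "p + c"] i by simp
  assume t: "1 \<le> t" "t \<le> b + 1"
  show "z (p + c + t + (c + 1)) \<longleftrightarrow> z (p + c + t)"
  proof (cases "t \<le> 2")
    case True
    have eq: "p + c + t + (c + 1) = ?P + c - r - 2 * (i + 1) - 2 + (t - 1)" using P by simp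
    have "t = 1 \<or> t = 2" using t True by linarith
    then have "\<not> z (p + c + t + (c + 1))"
      unfolding eq using C[of "t - 1"] by (elim disjE) simp_all
    moreover have "\<not> z (p + c + t)" using shape_D[OF sh, of t "p + c + t"] t True i by simp
    ultimately show ?thesis by simp
  next
    case False
    have "z (p + c + t) \<longleftrightarrow> even (t - 3) \<and> t - 3 < r + 2 * i + 2"
      using i False t r by (intro shape_E_tail[OF sh]) auto
    moreover have eq: "p + c + t + (c + 1) = ?P + c - r - 2 * (i + 1) + (t - 3)" using P by simp
    have "z (p + c + t + (c + 1)) \<longleftrightarrow> even (t - 3) \<and> t - 3 < r + 2 * (i + 1)"
    proof (cases "t = b + 1")
      case True
      have "p + c + t + (c + 1) = ?P + c" using True by simp
      then show ?thesis using shape_D[OF sh', of 0 "p + c + t + (c + 1)"] True r i by simp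
    next
      case f: False
      have "t - 3 < r + 2 * (i + 1)" using r t f by simp
      then show ?thesis
        unfolding eq using shape_C[OF sh' _ _ refl, of "t - 3"] False by simp
    qed
    ultimately show ?thesis by (simp add: algebra_simps)
  qed
qed

text \<open>Moved by \<open>b - 1\<close>, the run of three ones meets the final 011 of the same
  word, and what follows the run meets the first short block of the next word.\<close>

lemma preperiod_b_minus_1:
  assumes sh: "shape p i" and sh': "shape (p + (b + c + 2)) (i + 1)"
    and i: "0 \<le> i" "i + 1 = g" "g = q"
  shows "1 \<le> t \<Longrightarrow> t \<le> b + 1 \<Longrightarrow> z (p + c + t + (b - 1)) \<longleftrightarrow> z (p + c + t)"
    and "z (p + c + (b - 1)) \<noteq> z (p + c)"
proof -
  let ?P = "p + (b + c + 2)"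
  have r: "r + 2 * i + 2 = b - 2" using b_eq i by simp
  have tail: "\<not> z (p + c + b)" "\<not> z (p + c + b + 1)"
    using shape_tail[OF sh i(1)] i by auto
  show "z (p + c + (b - 1)) \<noteq> z (p + c)"
    using shape_F[OF sh, of "p + c + (b - 1)"] shape_D[OF sh, of 0 "p + c"] i by simp
  assume t: "1 \<le> t" "t \<le> b + 1"
  show "z (p + c + t + (b - 1)) \<longleftrightarrow> z (p + c + t)"
  proof (cases "t \<le> 2")
    case True
    have "t = 1 \<or> t = 2" using t True by auto
    then have "p + c + t + (b - 1) = p + c + b \<or> p + c + t + (b - 1) = p + c + b + 1" by auto
    then have "\<not> z (p + c + t + (b - 1))" using tail by metis
    moreover have "\<not> z (p + c + t)" using shape_D[OF sh, of t "p + c + t"] t True i by simp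
    ultimately show ?thesis by simp
  next
    case False
    have "z (p + c + t) \<longleftrightarrow> even (t - 3) \<and> t - 3 < r + 2 * i + 2"
      using i False t r by (intro shape_E_tail[OF sh]) auto
    moreover have "z (p + c + t + (b - 1)) \<longleftrightarrow> even (t - 3) \<and> t - 3 < b - 2"
      using shape_blocks_Y[OF _ i(3)[symmetric], of ?P 0 "t - 3" "p + c + t + (b - 1)"]
        sh' i t False by simp
    ultimately show ?thesis using r by simp
  qed
qed

text \<open>The run of ones is two longer than in the next word. Moved by \<open>b + c\<close>, its
  first two letters meet the final 01 of the next word's first alternating part, the others meet the
  shorter run, and then the second alternating parts coincide.\<close>

lemma preperiod_b_plus_c:
  assumes sh: "shape p i" and sh': "shape (p + (b + c + 2)) (i + 1)"
    and i: "0 \<le> i" "i + 1 = q" "q < g"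
  shows "1 \<le> t \<Longrightarrow> t \<le> b + 1 \<Longrightarrow> z (p + c + t + (b + c)) \<longleftrightarrow> z (p + c + t)"
    and "z (p + c + (b + c)) \<noteq> z (p + c)"
proof -
  let ?P = "p + (b + c + 2)"
  have "z (p + c + (b + c))"
    using shape_C[OF sh', of "r + 2 * i" "p + c + (b + c)"] r_nonneg i even_r by simp
  then show "z (p + c + (b + c)) \<noteq> z (p + c)"
    using shape_D[OF sh, of 0 "p + c"] i by simp
  assume t: "1 \<le> t" "t \<le> b + 1"
  consider "t = 1" | "2 \<le> t" "t \<le> 2 * (g - i)" | "2 * (g - i) < t" using t i by linarith
  then show "z (p + c + t + (b + c)) \<longleftrightarrow> z (p + c + t)"
  proof cases
    case 1
    have "\<not> z (p + c + t + (b + c))"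
      using shape_C[OF sh', of "r + 2 * i + 1" "p + c + t + (b + c)"] r_nonneg i even_r 1 by simp
    moreover have "\<not> z (p + c + t)" using shape_D[OF sh, of t "p + c + t"] 1 i by simp
    ultimately show ?thesis by simp
  next
    case 2
    have "\<not> z (p + c + t + (b + c))"
      using shape_D[OF sh', of "t - 2" "p + c + t + (b + c)"] 2 by simp
    moreover have "\<not> z (p + c + t)" using shape_D[OF sh, of t "p + c + t"] 2 by simp
    ultimately show ?thesis by simp
  next
    case 3
    let ?s = "t - 2 * (g - i) - 1"
    have "z (p + c + t) \<longleftrightarrow> even ?s \<and> ?s < r + 2 * i + 2"
      using i 3 t b_eq by (intro shape_E_tail[OF sh]) auto
    moreover have "z (p + c + t + (b + c)) \<longleftrightarrow> even ?s \<and> ?s < r + 2 * i + 2"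
    proof (cases "t = b + 1")
      case True
      then show ?thesis using shape_F[OF sh', of "p + c + t + (b + c)"] i b_eq by simp
    next
      case False
      then have "?s < r + 2 * (i + 1)" using t b_eq by simp
      then show ?thesis
        using shape_E[OF sh', of ?s "p + c + t + (b + c)"] 3 by simp
    qed
    ultimately show ?thesis by simp
  qed
qed

context
  fixes f :: "int \<Rightarrow> int" and k rn qn gn i :: nat and p :: int
  assumes binary: "\<And>n. f n \<in> {0, 1}" and zf: "\<And>n. z n \<longleftrightarrow> f n = 0"
    and k: "b = 2 * int k" and nat: "r = int rn" "q = int qn" "g = int gn"
    and sh: "shape p (int i)"
begin

lemma occurs_block_z:
  assumes "\<And>s. 0 \<le> s \<Longrightarrow> s \<le> 2 * int m \<Longrightarrow> z (n + s) \<longleftrightarrow> even s \<and> s < 2 * int m"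
  shows "occurs f n ([0, 1] \<up> m @ [1])"
  by (rule occurs_block[OF binary]) (use assms zf in auto)

lemma even_rn: "even rn"
  using even_r nat by simp

lemma occurs_X: "i \<le> qn \<Longrightarrow> n = p \<Longrightarrow> occurs f n (([0, 1] \<up> k @ [1]) \<up> (qn - i))"
proof (rule occurs_pow)
  fix j assume *: "i \<le> qn" "n = p" "j < qn - i"
  show "occurs f (n + int j * int (length ([0, 1 :: int] \<up> k @ [1]))) ([0, 1] \<up> k @ [1])"
  proof (rule occurs_block_z)
    fix s assume "0 \<le> s" "s \<le> 2 * int k"
    then show "z (n + int j * int (length ([0, 1 :: int] \<up> k @ [1])) + s) \<longleftrightarrow>
        even s \<and> s < 2 * int k"
      using shape_X[OF sh, of "int j" s] * k nat by (simp add: of_nat_diff algebra_simps)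
  qed
qed

lemma occurs_Y:
  "n = p + (q - int i) * (b + 1) \<Longrightarrow> occurs f n (([0, 1] \<up> (k - 1) @ [1]) \<up> i)"
proof (rule occurs_pow)
  fix j assume *: "n = p + (q - int i) * (b + 1)" "j < i"
  show "occurs f (n + int j * int (length ([0, 1 :: int] \<up> (k - 1) @ [1]))) ([0, 1] \<up> (k - 1) @ [1])"
  proof (rule occurs_block_z)
    fix s assume "0 \<le> s" "s \<le> 2 * int (k - 1)"
    then show "z (n + int j * int (length ([0, 1 :: int] \<up> (k - 1) @ [1])) + s) \<longleftrightarrow>
        even s \<and> s < 2 * int (k - 1)"
      using shape_Y[OF sh, of "int j" s] * k b_gt_1 by (simp add: of_nat_diff algebra_simps)
  qed
qed

lemma occurs_C:
  "n = p + c - r - 2 * int i \<Longrightarrow> occurs f n ([0, 1] \<up> (rn div 2 + i))"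
  by (rule occurs_alternating[OF binary])
    (use shape_C[OF sh] even_rn in \<open>auto simp: zf[symmetric] nat\<close>)

lemma occurs_D: "i \<le> gn \<Longrightarrow> n = p + c \<Longrightarrow> occurs f n ([1] \<up> (2 * (gn - i) + 1))"
  by (rule occurs_ones[OF binary])
    (use shape_D[OF sh] in \<open>auto simp: zf[symmetric] nat of_nat_diff\<close>)

lemma C_position: "p + c - r - 2 * int i = p + (q - int i) * (b + 1) + int i * (b - 1)"
  using c_eq by (simp add: algebra_simps)

lemma b_int: "1 \<le> k" "int k = int (rn div 2) + int gn + 1"
proof -
  show "1 \<le> k" using b_gt_1 k by simp
  have "int rn = 2 * int (rn div 2)" using even_rn by (auto elim!: evenE)
  then show "int k = int (rn div 2) + int gn + 1" using b_eq k nat by linarith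
qed

lemma length_parts:
  assumes "i \<le> qn"
  shows "int (length (([0, 1 :: int] \<up> k @ [1]) \<up> (qn - i))) = (q - int i) * (b + 1)"
    and "int (length (([0, 1 :: int] \<up> (k - 1) @ [1]) \<up> i)) = int i * (b - 1)"
    and "int (length ([0, 1 :: int] \<up> (rn div 2 + i))) = r + 2 * int i"
    and "i \<le> gn \<Longrightarrow> int (length ([1 :: int] \<up> (2 * (gn - i) + 1))) = 2 * (g - int i) + 1"
proof -
  show "int (length ([0, 1 :: int] \<up> (rn div 2 + i))) = r + 2 * int i"
    using even_rn nat by (auto elim!: evenE)
  show "int (length (([0, 1 :: int] \<up> k @ [1]) \<up> (qn - i))) = (q - int i) * (b + 1)"
  proof -
    obtain m where "qn = i + m" using assms le_Suc_ex by blast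
    then show ?thesis using k nat by (simp add: algebra_simps)
  qed
  show "int (length (([0, 1 :: int] \<up> (k - 1) @ [1]) \<up> i)) = int i * (b - 1)"
    using b_int(1) k by (cases k) (simp_all add: algebra_simps)
qed (simp add: nat of_nat_diff)

lemma occurs_T:
  assumes "i < qn" "i < gn"
  shows "occurs f p (([0, 1] \<up> k @ [1]) \<up> (qn - i) @ ([0, 1] \<up> (k - 1) @ [1]) \<up> i @
      [0, 1] \<up> (rn div 2 + i) @ [1] \<up> (2 * (gn - i) + 1) @ [0, 1] \<up> (k - (gn - i)) @ [1])"
proof -
  have le: "i \<le> qn" "i \<le> gn" using assms by auto
  have kg: "int (k - (gn - i)) = int (rn div 2) + int i + 1"
    using b_int assms by auto
  have rn: "r = 2 * int (rn div 2)" using even_rn nat by (auto elim!: evenE)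
  have "occurs f (p + c + 2 * (g - int i) + 1) ([0, 1] \<up> (k - (gn - i)) @ [1])"
    by (rule occurs_block_z, rule shape_E_tail[THEN trans, OF sh]) (use assms kg nat rn in auto)
  then show ?thesis
    using occurs_X[OF le(1) refl] occurs_Y[OF refl] occurs_C[OF refl] occurs_D[OF le(2) refl]
      C_position
    by (simp only: occurs_append length_parts[OF le(1)] length_parts(4)[OF le] add.assoc[symmetric])
      (simp add: algebra_simps)
qed

lemma occurs_P:
  assumes "i = gn" "gn \<le> qn"
  shows "occurs f p (([0, 1] \<up> k @ [1]) \<up> (qn - gn) @ ([0, 1] \<up> (k - 1) @ [1]) \<up> (gn + 1))"
proof -
  have le: "gn \<le> qn" "gn \<le> gn" using assms by auto
  have r: "r + 2 * g = b - 2" using b_eq by simp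
  \<comment> \<open>The last of the \<open>gn + 1\<close> short blocks is the first alternating part
    with the one after it.\<close>
  have "occurs f (p + c - r - 2 * int i) ([0, 1] \<up> (k - 1) @ [1])"
  proof (rule occurs_block_z)
    fix s assume s: "0 \<le> s" "s \<le> 2 * int (k - 1)"
    have k': "2 * int (k - 1) = b - 2" using k b_int(1) by (simp add: of_nat_diff)
    show "z (p + c - r - 2 * int i + s) \<longleftrightarrow> even s \<and> s < 2 * int (k - 1)"
    proof (cases "s = b - 2")
      case True
      then have eq: "p + c - r - 2 * int i + s = p + c" using assms nat r by simp
      show ?thesis unfolding eq using shape_D[OF sh, of 0 "p + c"] True k' assms nat by simp
    next
      case False
      then have "s < b - 2" using s k' by simp
      then show ?thesis
        unfolding k' using shape_C[OF sh _ _ refl, of s] s(1) r assms nat by simp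
    qed
  qed
  then show ?thesis
    using occurs_X[OF _ refl] occurs_Y[OF refl] C_position assms
    by (simp only: word_pow_add occurs_append length_parts[unfolded assms(1), OF le(1)] le
        add.assoc[symmetric]) (simp add: algebra_simps occurs_append)
qed

lemma occurs_P':
  assumes "i = qn" "qn \<le> gn"
  shows "occurs f p (([0, 1] \<up> (k - 1) @ [1]) \<up> qn @ [0, 1] \<up> (rn div 2 + qn) @
      [1] \<up> (2 * (gn - qn) + 1) @ [0, 1] \<up> (rn div 2 + qn) @ [1])"
proof -
  have le: "i \<le> qn" "i \<le> gn" using assms by auto
  have rn: "r = 2 * int (rn div 2)" using even_rn nat by (auto elim!: evenE)
  have "occurs f (p + c + 2 * (g - int i) + 1) ([0, 1] \<up> (rn div 2 + i) @ [1])"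
  proof (rule occurs_block_z)
    fix s assume s: "0 \<le> s" "s \<le> 2 * int (rn div 2 + i)"
    show "z (p + c + 2 * (g - int i) + 1 + s) \<longleftrightarrow> even s \<and> s < 2 * int (rn div 2 + i)"
    proof (cases "s = r + 2 * int i")
      case True
      then show ?thesis
        using shape_F[OF sh, of "p + c + 2 * (g - int i) + 1 + s"] b_eq rn assms nat by simp
    next
      case False
      then show ?thesis using shape_E[OF sh _ _ refl, of s] s rn by simp
    qed
  qed
  then show ?thesis
    using occurs_X[OF le(1) refl] occurs_Y[OF refl] occurs_C[OF refl] occurs_D[OF le(2) refl]
      C_position
    unfolding assms(1)[symmetric]
    by (simp only: occurs_append length_parts[OF le(1)] length_parts(4)[OF le] add.assoc[symmetric])
      (use assms nat in \<open>simp add: algebra_simps\<close>)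
qed

end

end

section \<open>The cases of the theorem\<close>

context
  fixes b c :: nat and A :: "nat set"
  assumes b: "1 < b" and bc: "b < c" and A: "A = {1, b, c}"
begin

interpretation subtraction_game "\<lambda>n. wseq A n = 0" "int b" "int c"
  by (rule wseq_game[OF b bc A])

private lemmas binary = wseq_binary[OF b bc A]
private lemmas purely = purely_periodic[OF b bc A]

lemma case_odd_odd:
  assumes "odd b" "odd c"
  shows "per A = 2 \<and> preper A = 0 \<and> wword A = [0, 1]\<^sup>\<omega>"
proof (rule purely)
  have z: "wseq A n = 0 \<longleftrightarrow> even n" if "0 \<le> n" for n
    using odd_odd[of n] assms that by simp
  show "occurs (wseq A) 0 [0, 1]"
    using z[of 0] z[of 1] binary[of 1] by (auto simp: occurs_def less_Suc_eq)
  show "wseq A (n + int 2) = 0 \<longleftrightarrow> wseq A n = 0" if "0 \<le> n" for n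
    using z[of n] z[of "n + 2"] that by simp
  show "\<exists>n\<ge>0. (wseq A (n + d) = 0) \<noteq> (wseq A n = 0)" if "0 < d" "d < int 2" for d
  proof -
    have "d = 1" using that by simp
    then show ?thesis using z[of 0] z[of 1] by (intro exI[of _ 0]) simp
  qed
qed auto

lemma case_odd_even:
  assumes "odd b" "even c"
  shows "per A = b + c \<and> preper A = 0 \<and> wword A = ([0, 1] \<up> (c div 2) @ [1] \<up> b)\<^sup>\<omega>"
proof (rule purely)
  have par: "odd (int b)" "even (int c)" using assms by auto
  note zeros = odd_even_zeros[OF par]
  have c2: "2 * (c div 2) = c" using assms by simp
  have "occurs (wseq A) 0 ([0, 1] \<up> (c div 2))"
    by (rule occurs_alternating[OF binary]) (use zeros(1) c2 in auto)
  moreover have "occurs (wseq A) (int c) ([1] \<up> b)"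
    by (rule occurs_ones[OF binary]) (use zeros(2) in auto)
  moreover have "int (length ([0, 1 :: int] \<up> (c div 2))) = int c" using c2 by simp
  ultimately show "occurs (wseq A) 0 ([0, 1] \<up> (c div 2) @ [1] \<up> b)"
    by (simp only: occurs_append add_0)
  show "length ([0, 1] \<up> (c div 2) @ [1] \<up> b) = b + c" using c2 by simp
  show "wseq A (n + int (b + c)) = 0 \<longleftrightarrow> wseq A n = 0" if "0 \<le> n" for n
    using odd_even_period[OF par that] by simp
  show "\<exists>n\<ge>0. (wseq A (n + d) = 0) \<noteq> (wseq A n = 0)" if "0 < d" "d < int (b + c)" for d
    using odd_even_not_period[OF par, of d] that by simp
qed (use b in simp)

lemma case_consecutive:
  assumes "even b" "c = b + 1" "k = b div 2"
  shows "per A = 2 * b \<and> preper A = 0 \<and> wword A = ([0, 1] \<up> k @ [1] \<up> b)\<^sup>\<omega>"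
proof (rule purely)
  have par: "even (int b)" "int c = int b + 1" using assms by auto
  note zeros = consecutive_zeros[OF par]
  have k: "2 * k = b" using assms by simp
  have "occurs (wseq A) 0 ([0, 1] \<up> k)"
    by (rule occurs_alternating[OF binary]) (use zeros(1) k in auto)
  moreover have "occurs (wseq A) (int b) ([1] \<up> b)"
    by (rule occurs_ones[OF binary]) (use zeros(2) in auto)
  moreover have "int (length ([0, 1 :: int] \<up> k)) = int b" using k by simp
  ultimately show "occurs (wseq A) 0 ([0, 1] \<up> k @ [1] \<up> b)"
    by (simp only: occurs_append add_0)
  show "length ([0, 1] \<up> k @ [1] \<up> b) = 2 * b" using k by simp
  show "wseq A (n + int (2 * b)) = 0 \<longleftrightarrow> wseq A n = 0" if "0 \<le> n" for n
    using consecutive_period[OF par that] by simp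
  show "\<exists>n\<ge>0. (wseq A (n + d) = 0) \<noteq> (wseq A n = 0)" if "0 < d" "d < int (2 * b)" for d
    using consecutive_not_period[OF par, of d] that by simp
qed (use b in simp)

lemma occurs_X_zero:
  assumes "b = 2 * k"
    and "\<And>n. 0 \<le> n \<Longrightarrow> n < int m * (int b + 1) \<Longrightarrow> wseq A n = 0 \<longleftrightarrow> X_zero n"
  shows "occurs (wseq A) 0 (([0, 1] \<up> k @ [1]) \<up> m)"
proof (rule occurs_pow)
  fix j assume j: "j < m"
  let ?n = "0 + int j * int (length ([0, 1 :: int] \<up> k @ [1]))"
  have n: "?n = int j * (int b + 1)" using assms(1) by simp
  have "(int j + 1) * (int b + 1) \<le> int m * (int b + 1)"
    using j by (intro mult_right_mono) auto
  then have le: "?n + int b + 1 \<le> int m * (int b + 1)" unfolding n by (simp add: algebra_simps)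
  show "occurs (wseq A) ?n ([0, 1] \<up> k @ [1])"
  proof (rule occurs_block[OF binary])
    fix s assume s: "0 \<le> s" "s \<le> 2 * int k"
    have "wseq A (?n + s) = 0 \<longleftrightarrow> X_zero (?n + s)"
      using le s assms(1) by (intro assms(2)) auto
    then show "wseq A (?n + s) = 0 \<longleftrightarrow> even s \<and> s < 2 * int k"
      using X_zero_iff[of "?n + s" "int j" s] s assms(1) unfolding n by simp
  qed
qed

lemma case_r_1_b:
  assumes "b = 2 * k" "c = q * (b + 1) + r" "r \<in> {1, b}"
  shows "per A = b + 1 \<and> preper A = 0 \<and> wword A = ([0, 1] \<up> k @ [1])\<^sup>\<omega>"
proof (rule purely)
  have ev: "even (int b)" using assms by simp
  have z: "wseq A n = 0 \<longleftrightarrow> X_zero n" if "0 \<le> n" for n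
    using X_zeros[OF ev, of "int q" "int r" n] assms that by (auto simp: algebra_simps)
  show "occurs (wseq A) 0 ([0, 1] \<up> k @ [1])"
    using occurs_X_zero[of k 1] z assms by simp
  show "length ([0, 1] \<up> k @ [1]) = b + 1" using assms by simp
  show "wseq A (n + int (b + 1)) = 0 \<longleftrightarrow> wseq A n = 0" if "0 \<le> n" for n
    using z[of n] z[of "n + (int b + 1)"] X_zero_period[of n] that by (simp add: algebra_simps)
  show "\<exists>n\<ge>0. (wseq A (n + d) = 0) \<noteq> (wseq A n = 0)" if "0 < d" "d < int (b + 1)" for d
    using X_not_period[OF ev z, of d] that by simp
qed simp

lemma case_r_odd:
  assumes "b = 2 * k" "c = q * (b + 1) + r" "1 < r" "r \<le> b" "odd r"
  shows "per A = b + c \<and> preper A = 0 \<and>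
    wword A = (([0, 1] \<up> k @ [1]) \<up> (q + 1) @ [1] \<up> (r - 1))\<^sup>\<omega>"
proof (rule purely)
  have par: "even (int b)" "int c = int q * (int b + 1) + int r" "1 < int r" "int r \<le> int b"
    "odd (int r)" using assms by (auto simp: algebra_simps)
  note zeros = odd_r_zeros[OF par]
  have len: "length (([0, 1 :: int] \<up> k @ [1]) \<up> (q + 1)) = (q + 1) * (b + 1)"
    using assms by simp
  have sum: "(q + 1) * (b + 1) + (r - 1) = b + c" using assms by simp
  have "occurs (wseq A) 0 (([0, 1] \<up> k @ [1]) \<up> (q + 1))"
    by (rule occurs_X_zero[OF assms(1)]) (use zeros(1) in \<open>simp add: add.commute\<close>)
  moreover have "occurs (wseq A) (int ((q + 1) * (b + 1))) ([1] \<up> (r - 1))"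
  proof (rule occurs_ones[OF binary])
    fix s assume s: "0 \<le> s" "s < int (r - 1)"
    have N: "int ((q + 1) * (b + 1)) = (int q + 1) * (int b + 1)" by (simp add: algebra_simps)
    have sum': "int ((q + 1) * (b + 1)) + int (r - 1) = int b + int c"
      using arg_cong[OF sum, of int] by (simp only: of_nat_add)
    show "wseq A (int ((q + 1) * (b + 1)) + s) \<noteq> 0"
    proof (rule zeros(2))
      show "(int q + 1) * (int b + 1) \<le> int ((q + 1) * (b + 1)) + s" unfolding N using s by simp
      show "int ((q + 1) * (b + 1)) + s < int b + int c" using s sum' by linarith
    qed
  qed
  ultimately show "occurs (wseq A) 0 (([0, 1] \<up> k @ [1]) \<up> (q + 1) @ [1] \<up> (r - 1))"
    by (simp only: occurs_append len add_0)
  show "length (([0, 1] \<up> k @ [1]) \<up> (q + 1) @ [1] \<up> (r - 1)) = b + c"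
    using len sum by (simp only: length_append length_word_pow) simp
  show "wseq A (n + int (b + c)) = 0 \<longleftrightarrow> wseq A n = 0" if "0 \<le> n" for n
    using odd_r_period[OF par that] by simp
  show "\<exists>n\<ge>0. (wseq A (n + d) = 0) \<noteq> (wseq A n = 0)" if "0 < d" "d < int (b + c)" for d
    using odd_r_not_period[OF par, of d] that by simp
qed (use b in simp)

section \<open>Even \<open>r\<close> at most \<open>b - 2\<close>: periods, preperiods and
  words\<close>

context
  fixes q r k \<gamma> :: nat
  assumes c_nat: "c = q * (b + 1) + r" and even_r_nat: "even r" and b_nat: "b = r + 2 * \<gamma> + 2"
    and k: "b = 2 * k" and q: "0 < q" and cond: "\<gamma> = 0 \<or> b + 1 < c"
begin

interpretation block_game "\<lambda>n. wseq A n = 0" "int b" "int c" "int q" "int r" "int \<gamma>"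
proof
  show "int c = int q * (int b + 1) + int r" using c_nat by (simp add: algebra_simps)
  show "int b = int r + 2 * int \<gamma> + 2" using b_nat by simp
qed (use even_r_nat q cond in auto)

private abbreviation (input) "T_length \<equiv> b + c + 2"

private abbreviation (input) "T_word i \<equiv> ([0, 1 :: int] \<up> k @ [1]) \<up> (q - i) @ ([0, 1] \<up> (k - 1) @ [1]) \<up> i
    @ [0, 1] \<up> (r div 2 + i) @ [1] \<up> (2 * (\<gamma> - i) + 1) @ [0, 1] \<up> (k - (\<gamma> - i)) @ [1]"

lemma shape_L:
  assumes "i \<le> q" "i \<le> \<gamma>"
  shows "shape (int (i * T_length)) (int i)"
  using shape_mult[of "int i"] assms by (simp add: algebra_simps)

lemma shape_L_Suc:
  assumes "Suc i \<le> q" "Suc i \<le> \<gamma>"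
  shows "shape (int (i * T_length) + (int b + int c + 2)) (int i + 1)"
proof -
  have "int (Suc i * T_length) = int (i * T_length) + (int b + int c + 2)" by simp
  then show ?thesis using shape_L[OF assms] by (simp only: of_nat_Suc add.commute)
qed

text \<open>For positive \<open>i\<close> this letter is the last one of T_{i-1}.\<close>

lemma not_z_before:
  assumes "i \<le> q" "i \<le> \<gamma>"
  shows "wseq A (int (i * T_length) - 1) \<noteq> 0"
proof (cases i)
  case 0
  then show ?thesis using not_z_neg[of "- 1"] by simp
next
  case (Suc j)
  have eq: "int (i * T_length) - 1 = int (j * T_length) + int c + int b + 1" using Suc by simp
  show ?thesis
    unfolding eq using shape_tail(2)[OF shape_L[of j]] assms Suc by simp
qed

lemma length_T:
  assumes "i \<le> q" "i \<le> \<gamma>"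
  shows "length (T_word i) = T_length"
proof -
  obtain m l where q': "q = i + m" and g': "\<gamma> = i + l" using assms le_Suc_ex by metis
  obtain t where t: "r = 2 * t" using even_r_nat by (elim evenE)
  have k': "k = t + i + l + 1" using b_nat k t g' by simp
  show ?thesis
    using c_nat k' by (simp add: q' g' t k algebra_simps)
qed

lemma occurs_T_words:
  assumes "\<mu> \<le> q" "\<mu> \<le> \<gamma>"
  shows "occurs (wseq A) 0 (concat (map (\<lambda>i. T_word i) [0..<\<mu>])) \<and>
    length (concat (map (\<lambda>i. T_word i) [0..<\<mu>])) = \<mu> * T_length"
proof (rule occurs_concat, rule conjI)
  fix i assume "i < \<mu>"
  then show "occurs (wseq A) (int (i * T_length)) (T_word i)" "length (T_word i) = T_length"
    using assms occurs_T[OF binary refl _ refl refl refl shape_L[of i], of k] k length_T[of i] by auto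
qed

lemma wword_P:
  assumes "\<gamma> \<le> q"
  shows "wword A = concat (map (\<lambda>i. T_word i) [0..<\<gamma>]) \<frown>
    (([0, 1] \<up> k @ [1]) \<up> (q - \<gamma>) @ ([0, 1] \<up> (k - 1) @ [1]) \<up> (\<gamma> + 1))\<^sup>\<omega>"
proof (rule wword_eq_conc_iter)
  let ?U = "concat (map (\<lambda>i. T_word i) [0..<\<gamma>])"
  let ?P = "([0, 1 :: int] \<up> k @ [1]) \<up> (q - \<gamma>) @ ([0, 1] \<up> (k - 1) @ [1]) \<up> (\<gamma> + 1)"
  have U: "occurs (wseq A) 0 ?U" "length ?U = \<gamma> * T_length" using occurs_T_words[of \<gamma>] assms by auto
  show "occurs (wseq A) 0 ?U" by (rule U)
  show "occurs (wseq A) (int (length ?U)) ?P"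
    unfolding U(2)
    using occurs_P[OF binary refl _ refl refl refl shape_L[of \<gamma>], of k] k assms by simp
  show "?P \<noteq> []" by simp
  have len: "int (length ?P) = int c + 1"
  proof -
    obtain m where q': "q = \<gamma> + m" using assms le_Suc_ex by metis
    obtain t where t: "r = 2 * t" using even_r_nat by (elim evenE)
    have k': "k = t + \<gamma> + 1" using b_nat k t by simp
    have "length ?P = c + 1" using c_nat k' by (simp add: q' t k algebra_simps)
    then show ?thesis by simp
  qed
  fix n assume "int (length ?U) \<le> n"
  then show "wseq A (n + int (length ?P)) = wseq A n"
    unfolding U(2) len wseq_eq_iff[OF b bc A, of "n + (int c + 1)" n]
    using shape_period_c_plus_1[OF shape_L[of \<gamma>], of n] not_z_before[of \<gamma>] assms by simp
qed

lemma wword_P':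
  assumes "q \<le> \<gamma>"
  shows "wword A = concat (map (\<lambda>i. T_word i) [0..<q]) \<frown>
    (([0, 1] \<up> (k - 1) @ [1]) \<up> q @ [0, 1] \<up> (r div 2 + q)
      @ [1] \<up> (2 * (\<gamma> - q) + 1) @ [0, 1] \<up> (r div 2 + q) @ [1])\<^sup>\<omega>"
proof (rule wword_eq_conc_iter)
  let ?U = "concat (map (\<lambda>i. T_word i) [0..<q])"
  let ?P = "([0, 1 :: int] \<up> (k - 1) @ [1]) \<up> q @ [0, 1] \<up> (r div 2 + q)
      @ [1] \<up> (2 * (\<gamma> - q) + 1) @ [0, 1] \<up> (r div 2 + q) @ [1]"
  have U: "occurs (wseq A) 0 ?U" "length ?U = q * T_length" using occurs_T_words[of q] assms by auto
  show "occurs (wseq A) 0 ?U" by (rule U)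
  show "occurs (wseq A) (int (length ?U)) ?P"
    unfolding U(2)
    using occurs_P'[OF binary refl _ refl refl refl shape_L[of q], of k] k assms by simp
  show "?P \<noteq> []" by simp
  have len: "int (length ?P) = int b + int c"
  proof -
    obtain m where g': "\<gamma> = q + m" using assms le_Suc_ex by metis
    obtain t where t: "r = 2 * t" using even_r_nat by (elim evenE)
    have k': "k = t + q + m + 1" using b_nat k t g' by simp
    have "length ?P = b + c" using c_nat k' by (simp add: g' t k algebra_simps)
    then show ?thesis by simp
  qed
  fix n assume "int (length ?U) \<le> n"
  then show "wseq A (n + int (length ?P)) = wseq A n"
    unfolding U(2) len wseq_eq_iff[OF b bc A, of "n + (int b + int c)" n]
    using shape_period_b_plus_c[OF shape_L[of q], of n] not_z_before[of q] assms by simp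
qed

text \<open>Common frame of the three regimes: periodicity from the start of P, agreement already on
  the last \<open>b + 1\<close> letters of the preceding word, and failure just before them. The
  preperiod is thus (\<mu>-1)(b+c+2)+c+1, which is the stated value. For \<gamma> = 0 that value
  would be negative, hence the guard.\<close>

lemma per_preper:
  fixes p \<mu> :: nat
  assumes \<mu>: "\<mu> = min q \<gamma>" and p: "1 \<le> p"
    and per: "\<And>n. int (\<mu> * T_length) \<le> n \<Longrightarrow> wseq A (n + int p) = 0 \<longleftrightarrow> wseq A n = 0"
    and minimal: "\<And>d. 0 < d \<Longrightarrow> d < int p \<Longrightarrow>
      \<exists>n\<ge>int (\<mu> * T_length). (wseq A (n + d) = 0) \<noteq> (wseq A n = 0)"
    and pre: "\<And>t i. \<mu> = Suc i \<Longrightarrow> 1 \<le> t \<Longrightarrow> t \<le> int b + 1 \<Longrightarrow>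
      wseq A (int (i * T_length) + int c + t + int p) = 0 \<longleftrightarrow> wseq A (int (i * T_length) + int c + t) = 0"
      "\<And>i. \<mu> = Suc i \<Longrightarrow>
        (wseq A (int (i * T_length) + int c + int p) = 0) \<noteq> (wseq A (int (i * T_length) + int c) = 0)"
  shows "per A = p \<and>
    (0 < \<gamma> \<longrightarrow> int (preper A) = int \<mu> * (int b + int c + 2) - int b - 1)"
proof (intro conjI impI)
  note eq_iff = wseq_eq_iff[OF b bc A]
  show per_p: "per A = p"
  proof (rule per_eqI[OF p])
    show "wseq A (n + int p) = wseq A n" if "int (\<mu> * T_length) \<le> n" for n
      using per[OF that] by (subst eq_iff)
    show "\<exists>n\<ge>int (\<mu> * T_length). wseq A (n + d) \<noteq> wseq A n" if "0 < d" "d < int p" for d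
      using minimal[OF that] by metis
  qed
  assume "0 < \<gamma>"
  then have "0 < \<mu>" using \<mu> q by simp
  then obtain i where i: "\<mu> = Suc i" by (auto simp: gr0_conv_Suc)
  have "preper A = i * T_length + c + 1"
  proof (rule preper_eqI[OF per_p])
    fix n assume n: "int (i * T_length + c + 1) \<le> n"
    show "wseq A (n + int p) = wseq A n"
    proof (cases "int (\<mu> * T_length) \<le> n")
      case True
      then show ?thesis using per by (subst eq_iff)
    next
      case False
      let ?t = "n - int (i * T_length) - int c"
      have "1 \<le> ?t" "?t \<le> int b + 1" using n False i by auto
      then show ?thesis using pre(1)[OF i, of ?t] by (subst eq_iff) simp
    qed
  next
    show "i * T_length + c + 1 = 0 \<or>
        wseq A (int (i * T_length + c + 1) - 1 + int p) \<noteq> wseq A (int (i * T_length + c + 1) - 1)"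
      using pre(2)[OF i] by (metis add_diff_cancel_right' of_nat_1 of_nat_add)
  qed
  then show "int (preper A) = int \<mu> * (int b + int c + 2) - int b - 1"
    using i by (simp add: algebra_simps)
qed

lemma case_gamma_less:
  assumes "\<gamma> < q"
  shows "per A = c + 1 \<and>
    (0 < \<gamma> \<longrightarrow> int (preper A) = int \<gamma> * (int b + int c + 2) - int b - 1)"
proof -
  have \<mu>: "\<gamma> = min q \<gamma>" using assms by simp
  note sh = shape_L[of \<gamma>, OF less_imp_le[OF assms] order_refl]
  note before = not_z_before[of \<gamma>, OF less_imp_le[OF assms] order_refl]
  show "per A = c + 1 \<and>
    (0 < \<gamma> \<longrightarrow> int (preper A) = int \<gamma> * (int b + int c + 2) - int b - 1)"
  proof (rule per_preper[OF \<mu>])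
    fix n assume "int (\<gamma> * T_length) \<le> n"
    then show "wseq A (n + int (c + 1)) = 0 \<longleftrightarrow> wseq A n = 0"
      using shape_period_c_plus_1[OF sh _ _ before, of n] assms by (simp add: algebra_simps)
  next
    fix d assume "0 < d" "d < int (c + 1)"
    then show "\<exists>n\<ge>int (\<gamma> * T_length). (wseq A (n + d) = 0) \<noteq> (wseq A n = 0)"
      using not_period_c_plus_1[OF sh _ _ before, of d] assms by simp
  next
    fix i assume i: "\<gamma> = Suc i"
    have sh1: "shape (int (i * T_length)) (int i)" "shape (int (i * T_length) + (int b + int c + 2)) (int i + 1)"
      using shape_L[of i] shape_L_Suc[of i] i assms by auto
    show "wseq A (int (i * T_length) + int c + t + int (c + 1)) = 0 \<longleftrightarrow>
        wseq A (int (i * T_length) + int c + t) = 0" if "1 \<le> t" "t \<le> int b + 1" for t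
      using preperiod_c_plus_1(1)[OF sh1 _ _ _ that] i assms by (simp add: algebra_simps)
    show "(wseq A (int (i * T_length) + int c + int (c + 1)) = 0) \<noteq> (wseq A (int (i * T_length) + int c) = 0)"
      using preperiod_c_plus_1(2)[OF sh1] i assms by (simp add: algebra_simps)
  qed simp
qed

lemma case_q_less:
  assumes "q < \<gamma>"
  shows "per A = b + c \<and> int (preper A) = int q * (int b + int c + 2) - int b - 1"
proof -
  have \<mu>: "q = min q \<gamma>" using assms by simp
  note sh = shape_L[of q, OF order_refl less_imp_le[OF assms]]
  note before = not_z_before[of q, OF order_refl less_imp_le[OF assms]]
  have "per A = b + c \<and>
    (0 < \<gamma> \<longrightarrow> int (preper A) = int q * (int b + int c + 2) - int b - 1)"
  proof (rule per_preper[OF \<mu>])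
    fix n assume "int (q * T_length) \<le> n"
    then show "wseq A (n + int (b + c)) = 0 \<longleftrightarrow> wseq A n = 0"
      using shape_period_b_plus_c[OF sh _ _ before, of n] assms by simp
  next
    fix d assume "0 < d" "d < int (b + c)"
    then show "\<exists>n\<ge>int (q * T_length). (wseq A (n + d) = 0) \<noteq> (wseq A n = 0)"
      using not_period_b_plus_c[OF sh _ _ before, of d] assms by simp
  next
    fix i assume i: "q = Suc i"
    have sh1: "shape (int (i * T_length)) (int i)" "shape (int (i * T_length) + (int b + int c + 2)) (int i + 1)"
      using shape_L[of i] shape_L_Suc[of i] i assms by auto
    show "wseq A (int (i * T_length) + int c + t + int (b + c)) = 0 \<longleftrightarrow>
        wseq A (int (i * T_length) + int c + t) = 0" if "1 \<le> t" "t \<le> int b + 1" for t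
      using preperiod_b_plus_c(1)[OF sh1 _ _ _ that] i assms by simp
    show "(wseq A (int (i * T_length) + int c + int (b + c)) = 0) \<noteq> (wseq A (int (i * T_length) + int c) = 0)"
      using preperiod_b_plus_c(2)[OF sh1] i assms by simp
  qed (use b in simp)
  then show ?thesis using assms by simp
qed

lemma case_eq:
  assumes "q = \<gamma>"
  shows "per A = b - 1 \<and> int (preper A) = int q * (int b + int c + 2) - int b - 1"
proof -
  have \<mu>: "q = min q \<gamma>" using assms by simp
  have b1: "int (b - 1) = int b - 1" using b by simp
  have iq: "int q = int \<gamma>" using assms by simp
  have sh: "shape (int (q * T_length)) (int \<gamma>)"
    using shape_L[of q] assms by simp
  have before: "wseq A (int (q * T_length) - 1) \<noteq> 0"
    using not_z_before[of q] assms by simp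
  have "per A = b - 1 \<and>
    (0 < \<gamma> \<longrightarrow> int (preper A) = int q * (int b + int c + 2) - int b - 1)"
  proof (rule per_preper[OF \<mu>])
    fix n assume "int (q * T_length) \<le> n"
    then show "wseq A (n + int (b - 1)) = 0 \<longleftrightarrow> wseq A n = 0"
      unfolding b1 using period_b_minus_1[OF sh _ iq before, of n] by simp
  next
    fix d assume "0 < d" "d < int (b - 1)"
    then show "\<exists>n\<ge>int (q * T_length). (wseq A (n + d) = 0) \<noteq> (wseq A n = 0)"
      unfolding b1 using not_period_b_minus_1[OF sh _ iq before, of d] by simp
  next
    fix i assume i: "q = Suc i"
    have sh1: "shape (int (i * T_length)) (int i)" "shape (int (i * T_length) + (int b + int c + 2)) (int i + 1)"
      using shape_L[of i] shape_L_Suc[of i] i assms by auto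
    show "wseq A (int (i * T_length) + int c + t + int (b - 1)) = 0 \<longleftrightarrow>
        wseq A (int (i * T_length) + int c + t) = 0" if "1 \<le> t" "t \<le> int b + 1" for t
      unfolding b1 using preperiod_b_minus_1(1)[OF sh1 _ _ _ that] i assms by simp
    show "(wseq A (int (i * T_length) + int c + int (b - 1)) = 0) \<noteq> (wseq A (int (i * T_length) + int c) = 0)"
      unfolding b1 using preperiod_b_minus_1(2)[OF sh1] i assms by simp
  qed (use b in simp)
  then show ?thesis using q assms by simp
qed

text \<open>Here \<mu> = 0: no word T_i precedes the period, and P is \<open>q\<close> long blocks
  followed by one short block.\<close>

lemma case_gamma_0:
  assumes "\<gamma> = 0"
  shows "per A = c + 1 \<and> preper A = 0 \<and>
    wword A = (([0, 1] \<up> k @ [1]) \<up> q @ [0, 1] \<up> (k - 1) @ [1])\<^sup>\<omega>"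
proof (intro conjI)
  show per: "per A = c + 1" using case_gamma_less assms q by simp
  show "preper A = 0"
  proof (rule preper_eqI[OF per])
    show "wseq A (n + int (c + 1)) = wseq A n" if "int 0 \<le> n" for n
      using shape_period_c_plus_1[of 0 n] shape_0 not_z_neg[of "- 1"] assms that
      by (subst wseq_eq_iff[OF b bc A]) (simp add: algebra_simps)
  qed simp
  show "wword A = (([0, 1] \<up> k @ [1]) \<up> q @ [0, 1] \<up> (k - 1) @ [1])\<^sup>\<omega>"
    using wword_P assms by simp
qed

end

end

theorem theorem4p1:
  fixes b c q r k \<gamma> \<mu> :: nat
    and A :: "nat set"
    and T :: "nat \<Rightarrow> int list"
    and P P' :: "int list"
  assumes "1 < b" and "b < c"
    and "A = {1, b, c}"
    and "q = c div (b + 1)" and "r = c mod (b + 1)"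
    and "even b \<Longrightarrow> k = b div 2"
    and "even (b - r) \<Longrightarrow> \<gamma> = (b - r - 2) div 2"
    and "\<mu> = min q \<gamma>"
    and "T = (\<lambda>i. ([0,1] \<up> k @ [1]) \<up> (q - i) @ ([0,1] \<up> (k - 1) @ [1]) \<up> i
                  @ [0,1] \<up> (r div 2 + i) @ [1] \<up> (2 * (\<gamma> - i) + 1)
                  @ [0,1] \<up> (k - (\<gamma> - i)) @ [1])"
    and "P = ([0,1] \<up> k @ [1]) \<up> (q - \<gamma>) @ ([0,1] \<up> (k - 1) @ [1]) \<up> (\<gamma> + 1)"
    and "P' = ([0,1] \<up> (k - 1) @ [1]) \<up> q @ [0,1] \<up> (r div 2 + q)
              @ [1] \<up> (2 * (\<gamma> - q) + 1) @ [0,1] \<up> (r div 2 + q) @ [1]"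
  shows
    "(odd b \<and> odd c \<longrightarrow>
        per A = 2 \<and> preper A = 0 \<and> wword A = [0,1]\<^sup>\<omega>)
   \<and> (odd b \<and> even c \<longrightarrow>
        per A = b + c \<and> preper A = 0 \<and>
        wword A = ([0,1] \<up> (c div 2) @ [1] \<up> b)\<^sup>\<omega>)
   \<and> (even b \<and> c = b + 1 \<longrightarrow>
        per A = 2 * b \<and> preper A = 0 \<and>
        wword A = ([0,1] \<up> k @ [1] \<up> b)\<^sup>\<omega>)
   \<and> (even b \<and> r \<in> {1, b} \<longrightarrow>
        per A = b + 1 \<and> preper A = 0 \<and>
        wword A = ([0,1] \<up> k @ [1])\<^sup>\<omega>)
   \<and> (even b \<and> 1 < r \<and> odd r \<longrightarrow>
        per A = b + c \<and> preper A = 0 \<and>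
        wword A = (([0,1] \<up> k @ [1]) \<up> (q + 1) @ [1] \<up> (r - 1))\<^sup>\<omega>)
   \<and> (even b \<and> r = b - 2 \<longrightarrow>
        per A = c + 1 \<and> preper A = 0 \<and>
        wword A = (([0,1] \<up> k @ [1]) \<up> q @ [0,1] \<up> (k - 1) @ [1])\<^sup>\<omega>)
   \<and> (even b \<and> b + 1 < c \<and> r < b - 2 \<and> even r \<and> \<gamma> < q \<longrightarrow>
        per A = c + 1 \<and> int (preper A) = int \<gamma> * (int b + int c + 2) - int b - 1)
   \<and> (even b \<and> b + 1 < c \<and> r < b - 2 \<and> even r \<and> q < \<gamma> \<longrightarrow>
        per A = b + c \<and> int (preper A) = int q * (int b + int c + 2) - int b - 1)
   \<and> (even b \<and> b + 1 < c \<and> r < b - 2 \<and> even r \<and> q = \<gamma> \<longrightarrow>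
        per A = b - 1 \<and> int (preper A) = int q * (int b + int c + 2) - int b - 1)
   \<and> (even b \<and> b + 1 < c \<and> r < b - 2 \<and> even r \<longrightarrow>
        (\<gamma> \<le> q \<longrightarrow> wword A = concat (map T [0..<\<mu>]) \<frown> P\<^sup>\<omega>) \<and>
        (q \<le> \<gamma> \<longrightarrow> wword A = concat (map T [0..<\<mu>]) \<frown> P'\<^sup>\<omega>))"
proof -
  note base = assms(1-3)
  have c_eq: "c = q * (b + 1) + r"
    unfolding assms(4,5) by (rule div_mult_mod_eq[symmetric])
  have r_le: "r \<le> b"
    using assms(5) mod_less_divisor[of "b + 1" c] by simp
  have k: "b = 2 * k" if "even b" using assms(6)[OF that] that by simp
  have q_pos: "0 < q" using assms(2,4) by (simp add: div_greater_zero_iff)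
  \<comment> \<open>With \<open>1 < b\<close> and \<open>r \<le> b - 2\<close> the truncated
    subtractions in the definition of \<gamma> are exact.\<close>
  have cond: "b = r + 2 * \<gamma> + 2" if "even b" "even r" "r \<le> b - 2"
  proof -
    have "even (b - r)" using that by simp
    then show ?thesis using assms(1,7) that by (auto elim!: evenE)
  qed
  have i: "per A = 2 \<and> preper A = 0 \<and> wword A = [0,1]\<^sup>\<omega>" if "odd b" "odd c"
    using case_odd_odd[OF base that] .
  have ii: "per A = b + c \<and> preper A = 0 \<and> wword A = ([0,1] \<up> (c div 2) @ [1] \<up> b)\<^sup>\<omega>"
    if "odd b" "even c"
    using case_odd_even[OF base that] .
  have iii: "per A = 2 * b \<and> preper A = 0 \<and> wword A = ([0,1] \<up> k @ [1] \<up> b)\<^sup>\<omega>"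
    if "even b" "c = b + 1"
    using case_consecutive[OF base that assms(6)[OF that(1)]] .
  have iv: "per A = b + 1 \<and> preper A = 0 \<and> wword A = ([0,1] \<up> k @ [1])\<^sup>\<omega>"
    if "even b" "r \<in> {1, b}"
    using case_r_1_b[OF base k[OF that(1)] c_eq that(2)] .
  have v: "per A = b + c \<and> preper A = 0 \<and>
      wword A = (([0,1] \<up> k @ [1]) \<up> (q + 1) @ [1] \<up> (r - 1))\<^sup>\<omega>"
    if "even b" "1 < r" "odd r"
    using case_r_odd[OF base k[OF that(1)] c_eq that(2) r_le that(3)] .
  have vi: "per A = c + 1 \<and> preper A = 0 \<and>
      wword A = (([0,1] \<up> k @ [1]) \<up> q @ [0,1] \<up> (k - 1) @ [1])\<^sup>\<omega>"
    if "even b" "r = b - 2"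
  proof -
    have "even r" using that by simp
    then have b: "b = r + 2 * \<gamma> + 2" using cond that by simp
    then have "\<gamma> = 0" using that by simp
    then show ?thesis
      using case_gamma_0[OF base c_eq \<open>even r\<close> b k[OF that(1)] q_pos] by simp
  qed
  have rest: "(\<gamma> < q \<longrightarrow>
        per A = c + 1 \<and> int (preper A) = int \<gamma> * (int b + int c + 2) - int b - 1) \<and>
      (q < \<gamma> \<longrightarrow>
        per A = b + c \<and> int (preper A) = int q * (int b + int c + 2) - int b - 1) \<and>
      (q = \<gamma> \<longrightarrow>
        per A = b - 1 \<and> int (preper A) = int q * (int b + int c + 2) - int b - 1) \<and>
      (\<gamma> \<le> q \<longrightarrow> wword A = concat (map T [0..<\<mu>]) \<frown> P\<^sup>\<omega>) \<and>
      (q \<le> \<gamma> \<longrightarrow> wword A = concat (map T [0..<\<mu>]) \<frown> P'\<^sup>\<omega>)"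
    if "even b" "b + 1 < c" "r < b - 2" "even r"
  proof -
    have b: "b = r + 2 * \<gamma> + 2" using cond that by simp
    then have "0 < \<gamma>" using that by simp
    have "\<gamma> = 0 \<or> b + 1 < c" using that by simp
    note blocks = base c_eq that(4) b k[OF that(1)] q_pos this
    show ?thesis
      using case_gamma_less[OF blocks] case_q_less[OF blocks] case_eq[OF blocks]
        wword_P[OF blocks] wword_P'[OF blocks] \<open>0 < \<gamma>\<close>
      by (simp add: assms(8-11) min_def)
  qed
  show ?thesis using i ii iii iv v vi rest by blast
qed

end
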